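(* Let $\varepsilon>0$ be sufficiently small, let $\alpha\ge1500\varepsilon^{-2}$, let $G$ be an $\alpha$-pseudo-random graph on $[n]$, let $v_0\in[n]$, let $L_2=(2+\varepsilon)n\ln n$, and let $(X_t)$ be a $\frac12$-lazy simple random walk on $G$ starting at $v_0$. For $v\in[n]$ let $\nu(v)=|\{0<t\le L_2:\ X_t=v,\ X_{t+1}\ne v\}|$. Then there exists $\rho>0$ such that with high probability $\nu(v)\ge\rho\ln n$ for every $v\in[n]$.
   Context: A graph $G$ on $[n]$ is $\alpha$-pseudo-random (for $\alpha=\alpha(n)>0$) if: (P1) $G$ is connected; (P2) for every $v$, $|d(v)-\alpha\ln n|\le2\sqrt\alpha\ln n$ and $\frac{5\alpha}{6}\ln n\le d(v)\le\frac{4\alpha}{3}\ln n$; (P3) for every non-empty $S\subseteq[n]$ with $|S|\le0.8n$, $|\partial S|>\frac{|S||S^c|\alpha\ln n}{2n}$; (P4) for every large enough constant $K>0$ and every non-empty $A$ with $|A|=a$: if $\frac n{\alpha\ln n}\le a\le\frac n{\ln n}$ then $|E(A,\{u\in N(A):|E(u,A)|\ge Ka\alpha\ln n/n\})|\le a\alpha\ln n/K$, and if $a<\frac n{\alpha\ln n}$ then $|E(A,\{u\in N(A):|E(u,A)|\ge K\})|\le a\alpha\ln n/\ln K$; (P5) for every $A$ with $|A|=n(\ln\ln n)^{1.5}/\ln n$ at most $|A|/2$ vertices $v\notin A$ have $|E(v,A)|\le\alpha(\ln\ln n)^{1.5}/2$; (P6) if $\alpha<\ln^2n$ then for every $v$,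 every $0\le r\le\frac{\ln n}{15\ln\ln n}$ and every $w\in N(v,r)$, $|E(w,B(v,r))|\le5$. Here $E(A,B)$ is the set of edges between $A$ and $B$, $N(A)$ the external neighbourhood, $\partial S$ the edge boundary, $B(v,r)$ the ball of radius $r$ around $v$ in graph distance, $N(v,r)=B(v,r)\setminus B(v,r-1)$. A $\frac12$-lazy random walk stays put with probability $1/2$ at each step and otherwise moves to a uniformly random neighbour. "With high probability" means with probability tending to $1$ as $n\to\infty$. *)

theory Defs
  imports "HOL-Probability.Probability" "HOL-Library.Extended_Nat"
begin

text \<open>
  A simple graph on \<open>[n] = {1..n}\<close> is given by its edge set \<open>E\<close>, a set of two-element
  subsets of \<open>{1..n}\<close>.
\<close>

definition graph_on :: "nat \<Rightarrow> nat set set \<Rightarrow> bool" where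
  "graph_on n E \<longleftrightarrow> (\<forall>e\<in>E. e \<subseteq> {1..n} \<and> card e = 2)"

definition adj_rel :: "nat set set \<Rightarrow> (nat \<times> nat) set" where
  "adj_rel E = {(u, v). {u, v} \<in> E \<and> u \<noteq> v}"

definition nbrs :: "nat set set \<Rightarrow> nat \<Rightarrow> nat set" where
  "nbrs E v = {u. (v, u) \<in> adj_rel E}"

definition deg :: "nat set set \<Rightarrow> nat \<Rightarrow> nat" where
  "deg E v = card (nbrs E v)"

definition edges_between :: "nat set set \<Rightarrow> nat set \<Rightarrow> nat set \<Rightarrow> nat set set" where
  "edges_between E A B = {e \<in> E. \<exists>a\<in>A. \<exists>b\<in>B. e = {a, b}}"

definition ext_nbhd :: "nat set set \<Rightarrow> nat set \<Rightarrow> nat set" where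
  "ext_nbhd E A = (\<Union>a\<in>A. nbrs E a) - A"

definition edge_boundary :: "nat \<Rightarrow> nat set set \<Rightarrow> nat set \<Rightarrow> nat set set" where
  "edge_boundary n E S = edges_between E S ({1..n} - S)"

definition graph_connected :: "nat \<Rightarrow> nat set set \<Rightarrow> bool" where
  "graph_connected n E \<longleftrightarrow> (\<forall>u\<in>{1..n}. \<forall>v\<in>{1..n}. (u, v) \<in> (adj_rel E)\<^sup>*)"

definition graph_dist :: "nat set set \<Rightarrow> nat \<Rightarrow> nat \<Rightarrow> enat" where
  "graph_dist E u v = (INF k\<in>{k. (u, v) \<in> adj_rel E ^^ k}. enat k)"

definition graph_ball :: "nat \<Rightarrow> nat set set \<Rightarrow> nat \<Rightarrow> nat \<Rightarrow> nat set" where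
  "graph_ball n E v r = {u \<in> {1..n}. graph_dist E v u \<le> enat r}"

text \<open>
  \<open>N(v,r) = B(v,r) \<setminus> B(v,r-1)\<close>, where \<open>B(v,-1)\<close> is empty; the case \<open>r = 0\<close> is separate
  because subtraction of natural numbers truncates.
\<close>

definition graph_sphere :: "nat \<Rightarrow> nat set set \<Rightarrow> nat \<Rightarrow> nat \<Rightarrow> nat set" where
  "graph_sphere n E v r =
     graph_ball n E v r - (if r = 0 then {} else graph_ball n E v (r - 1))"


definition P1 :: "nat \<Rightarrow> nat set set \<Rightarrow> bool" where
  "P1 n E \<longleftrightarrow> graph_connected n E"

definition P2 :: "real \<Rightarrow> nat \<Rightarrow> nat set set \<Rightarrow> bool" where
  "P2 \<alpha> n E \<longleftrightarrow> (\<forall>v\<in>{1..n}.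
     \<bar>real (deg E v) - \<alpha> * ln (real n)\<bar> \<le> 2 * sqrt \<alpha> * ln (real n) \<and>
     5 * \<alpha> / 6 * ln (real n) \<le> real (deg E v) \<and>
     real (deg E v) \<le> 4 * \<alpha> / 3 * ln (real n))"

definition P3 :: "real \<Rightarrow> nat \<Rightarrow> nat set set \<Rightarrow> bool" where
  "P3 \<alpha> n E \<longleftrightarrow> (\<forall>S. S \<noteq> {} \<and> S \<subseteq> {1..n} \<and> real (card S) \<le> 0.8 * real n \<longrightarrow>
     real (card (edge_boundary n E S)) >
       real (card S) * real (card ({1..n} - S)) * \<alpha> * ln (real n) / (2 * real n))"

text \<open>The property for one value of the constant \<open>K\<close>.\<close>

definition P4 :: "real \<Rightarrow> real \<Rightarrow> nat \<Rightarrow> nat set set \<Rightarrow> bool" where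
  "P4 K \<alpha> n E \<longleftrightarrow> (\<forall>A. A \<noteq> {} \<and> A \<subseteq> {1..n} \<longrightarrow> (let a = real (card A) in
     (real n / (\<alpha> * ln (real n)) \<le> a \<and> a \<le> real n / ln (real n) \<longrightarrow>
        real (card (edges_between E A
          {u \<in> ext_nbhd E A. real (card (edges_between E {u} A)) \<ge> K * a * \<alpha> * ln (real n) / real n}))
        \<le> a * \<alpha> * ln (real n) / K) \<and>
     (a < real n / (\<alpha> * ln (real n)) \<longrightarrow>
        real (card (edges_between E A
          {u \<in> ext_nbhd E A. real (card (edges_between E {u} A)) \<ge> K}))
        \<le> a * \<alpha> * ln (real n) / ln K)))"

text \<open>The prescribed size of \<open>A\<close> need not be an integer; it is rounded down.\<close>

definition P5 :: "real \<Rightarrow> nat \<Rightarrow> nat set set \<Rightarrow> bool" where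
  "P5 \<alpha> n E \<longleftrightarrow> (\<forall>A. A \<subseteq> {1..n} \<and>
       card A = nat \<lfloor>real n * ln (ln (real n)) powr 1.5 / ln (real n)\<rfloor> \<longrightarrow>
     real (card {v \<in> {1..n} - A.
        real (card (edges_between E {v} A)) \<le> \<alpha> * ln (ln (real n)) powr 1.5 / 2})
     \<le> real (card A) / 2)"

definition P6 :: "real \<Rightarrow> nat \<Rightarrow> nat set set \<Rightarrow> bool" where
  "P6 \<alpha> n E \<longleftrightarrow> (\<alpha> < (ln (real n))\<^sup>2 \<longrightarrow>
     (\<forall>v\<in>{1..n}. \<forall>r::nat. real r \<le> ln (real n) / (15 * ln (ln (real n))) \<longrightarrow>
       (\<forall>w\<in>graph_sphere n E v r. card (edges_between E {w} (graph_ball n E v r)) \<le> 5)))"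

text \<open>
  Pseudo-randomness is an asymptotic notion for a sequence of graphs, the \<open>n\<close>-th one on \<open>[n]\<close>:
  the constant \<open>K\<close> in \<open>P4\<close> must not depend on \<open>n\<close> (for a single graph, \<open>P4\<close> holds trivially
  once \<open>K\<close> exceeds all degrees), and for small \<open>n\<close> the degree condition \<open>P2\<close> cannot be met
  when \<open>\<alpha>\<close> is large. Accordingly, each large enough constant \<open>K\<close> is fixed first, and the
  properties are required for all sufficiently large \<open>n\<close>.
\<close>

definition pseudo_random :: "(nat \<Rightarrow> real) \<Rightarrow> (nat \<Rightarrow> nat set set) \<Rightarrow> bool" where
  "pseudo_random \<alpha> G \<longleftrightarrow>
     (\<forall>\<^sub>F n in sequentially. \<alpha> n > 0 \<and> graph_on n (G n) \<and>
        P1 n (G n) \<and> P2 (\<alpha> n) n (G n) \<and> P3 (\<alpha> n) n (G n) \<and>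
        P5 (\<alpha> n) n (G n) \<and> P6 (\<alpha> n) n (G n)) \<and>
     (\<exists>K0>0. \<forall>K\<ge>K0. \<forall>\<^sub>F n in sequentially. P4 K (\<alpha> n) n (G n))"


text \<open>
  One step of the 1/2-lazy simple random walk. It is meaningful at vertices \<open>v\<close> with a nonempty
  finite neighbourhood, hence at all vertices of a connected graph on \<open>[n]\<close> with \<open>n \<ge> 2\<close>.
\<close>

definition lazy_step :: "nat set set \<Rightarrow> nat \<Rightarrow> nat pmf" where
  "lazy_step E v =
     bind_pmf (bernoulli_pmf (1/2)) (\<lambda>stay. if stay then return_pmf v else pmf_of_set (nbrs E v))"

text \<open>The joint law of \<open>[X\<^sub>0, \<dots>, X\<^sub>T]\<close>; the position \<open>X\<^sub>t\<close> is \<open>xs ! t\<close>.\<close>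

primrec lazy_walk :: "nat set set \<Rightarrow> nat \<Rightarrow> nat \<Rightarrow> nat list pmf" where
  "lazy_walk E v0 0 = return_pmf [v0]"
| "lazy_walk E v0 (Suc T) =
     bind_pmf (lazy_walk E v0 T)
       (\<lambda>xs. map_pmf (\<lambda>y. xs @ [y]) (lazy_step E (last xs)))"

text \<open>
  The count is determined by the positions up to time \<open>\<lfloor>L\<rfloor> + 1\<close>, so \<open>xs\<close> must be a
  trajectory at least that long.
\<close>

definition num_exits :: "real \<Rightarrow> nat list \<Rightarrow> nat \<Rightarrow> nat" where
  "num_exits L xs v = card {t. 0 < t \<and> real t \<le> L \<and> xs ! t = v \<and> xs ! (t + 1) \<noteq> v}"

definition L2 :: "real \<Rightarrow> nat \<Rightarrow> real" where
  "L2 \<epsilon> n = (2 + \<epsilon>) * real n * ln (real n)"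

end

theory Submission
  imports Defs "HOL-Real_Asymp.Real_Asymp"
begin

text \<open>
  For fixed \<open>v\<close> and small \<open>q\<close>, the expectation of \<open>q\<close> to the number of exits from \<open>v\<close> is a power of the
  transition operator with the row of \<open>v\<close> tilted by \<open>q\<close>. This operator is self-adjoint and positive
  semidefinite for a suitable inner product. By (P3) and Cheeger's inequality the graph has a constant
  spectral gap, and since the degrees tend to infinity, this forces the norm of the tilted operator
  below \<open>1 - (1 - o(1)) (1 - q) d(v) / (2 vol)\<close>, where \<open>vol\<close> is the sum of all degrees. By (P2) the
  factor \<open>n d(v) / vol\<close> is at least \<open>1 - \<epsilon>/9\<close>, so after \<open>(2 + \<epsilon>) n ln n\<close> steps the expectation is
  \<open>O(n powr (-1 - \<epsilon>/5))\<close>. To avoid losing a factor \<open>sqrt n\<close> when passing from the norm to the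
  starting vertex, the first \<open>O(ln n)\<close> steps are bounded by untilted ones, which mix. Markov's
  inequality and a union bound over \<open>v\<close> conclude.
\<close>

subsection \<open>Cheeger's inequality\<close>

locale sym_graph =
  fixes V :: "'a set" and N :: "'a \<Rightarrow> 'a set"
  assumes finite_V: "finite V"
    and N_subset: "u \<in> V \<Longrightarrow> N u \<subseteq> V"
    and N_sym: "u \<in> V \<Longrightarrow> w \<in> V \<Longrightarrow> w \<in> N u \<longleftrightarrow> u \<in> N w"
    and N_nonempty: "u \<in> V \<Longrightarrow> N u \<noteq> {}"
    and V_nonempty: "V \<noteq> {}"
begin

definition d :: "'a \<Rightarrow> real" where "d u = real (card (N u))"

definition dart_sum :: "('a \<Rightarrow> 'a \<Rightarrow> real) \<Rightarrow> real" where
  "dart_sum \<phi> = (\<Sum>p\<in>Sigma V N. \<phi> (fst p) (snd p))"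

text \<open>Both orientations of an edge are summed, so this is twice the usual Dirichlet energy.
  Together with the laziness factor 1/2 this produces the \<open>form f / 4\<close> of later
  identities.\<close>

definition form :: "('a \<Rightarrow> real) \<Rightarrow> real" where
  "form f = dart_sum (\<lambda>u w. (f u - f w)\<^sup>2)"

lemma finite_N: "u \<in> V \<Longrightarrow> finite (N u)"
  using N_subset finite_V finite_subset by blast

lemma N_in: "u \<in> V \<Longrightarrow> w \<in> N u \<Longrightarrow> w \<in> V"
  using N_subset by blast

lemma N_symD: "u \<in> V \<Longrightarrow> w \<in> N u \<Longrightarrow> u \<in> N w"
  using N_in N_sym by blast

lemma d_ge_1: "u \<in> V \<Longrightarrow> d u \<ge> 1"
  using finite_N[of u] N_nonempty[of u] card_gt_0_iff[of "N u"] unfolding d_def by linarith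

lemma d_pos: "u \<in> V \<Longrightarrow> d u > 0"
  using d_ge_1[of u] by simp

lemma dart_sum_eq: "dart_sum \<phi> = (\<Sum>u\<in>V. \<Sum>w\<in>N u. \<phi> u w)"
  unfolding dart_sum_def by (subst sum.Sigma) (auto simp: finite_V finite_N case_prod_beta)

lemma dart_sum_swap: "dart_sum \<phi> = dart_sum (\<lambda>u w. \<phi> w u)"
  unfolding dart_sum_def
proof (rule sum.reindex_bij_witness[of _ prod.swap prod.swap])
  show "prod.swap p \<in> Sigma V N" if "p \<in> Sigma V N" for p
    using that N_in[of "fst p" "snd p"] N_symD[of "fst p" "snd p"] by auto
  then show "prod.swap p \<in> Sigma V N" if "p \<in> Sigma V N" for p
    using that .
qed auto

lemma dart_sum_fst: "dart_sum (\<lambda>u w. x u) = (\<Sum>u\<in>V. d u * x u)"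
  unfolding dart_sum_eq d_def by simp

lemma dart_sum_snd: "dart_sum (\<lambda>u w. x w) = (\<Sum>u\<in>V. d u * x u)"
  using dart_sum_fst[of x] dart_sum_swap[of "\<lambda>u w. x u"] by simp

lemma dart_sum_add: "dart_sum (\<lambda>u w. \<phi> u w + \<psi> u w) = dart_sum \<phi> + dart_sum \<psi>"
  unfolding dart_sum_def by (rule sum.distrib)

lemma dart_sum_diff: "dart_sum (\<lambda>u w. \<phi> u w - \<psi> u w) = dart_sum \<phi> - dart_sum \<psi>"
  unfolding dart_sum_def by (rule sum_subtractf)

lemma dart_sum_cmult: "dart_sum (\<lambda>u w. c * \<phi> u w) = c * dart_sum \<phi>"
  unfolding dart_sum_def by (rule sum_distrib_left[symmetric])

lemma dart_sum_mono:
  "(\<And>u w. u \<in> V \<Longrightarrow> w \<in> V \<Longrightarrow> w \<in> N u \<Longrightarrow> \<phi> u w \<le> \<psi> u w) \<Longrightarrow> dart_sum \<phi> \<le> dart_sum \<psi>"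
  unfolding dart_sum_def by (rule sum_mono) (metis N_in mem_Sigma_iff prod.collapse)

lemma dart_sum_cong:
  "(\<And>u w. u \<in> V \<Longrightarrow> w \<in> V \<Longrightarrow> w \<in> N u \<Longrightarrow> \<phi> u w = \<psi> u w) \<Longrightarrow> dart_sum \<phi> = dart_sum \<psi>"
  unfolding dart_sum_def by (rule sum.cong[OF refl]) (metis N_in mem_Sigma_iff prod.collapse)

lemma dart_sum_nonneg:
  "(\<And>u w. u \<in> V \<Longrightarrow> w \<in> V \<Longrightarrow> 0 \<le> \<phi> u w) \<Longrightarrow> 0 \<le> dart_sum \<phi>"
  unfolding dart_sum_def by (rule sum_nonneg) (metis N_in mem_Sigma_iff prod.collapse)

lemma form_eq:
  "form f = 2 * (\<Sum>u\<in>V. d u * (f u)\<^sup>2) - 2 * dart_sum (\<lambda>u w. f u * f w)"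
proof -
  have "form f = dart_sum (\<lambda>u w. ((f u)\<^sup>2 + (f w)\<^sup>2) - 2 * (f u * f w))"
    unfolding form_def by (rule dart_sum_cong) (simp add: power2_eq_square algebra_simps)
  then show ?thesis
    unfolding dart_sum_diff dart_sum_add dart_sum_cmult dart_sum_fst dart_sum_snd by simp
qed

text \<open>Adding this to \<open>form_eq\<close> cancels the mixed terms and leaves four times the
  degree-weighted square sum, so nonnegativity of either sum bounds the other.\<close>

lemma dart_sum_plus_sq:
  "dart_sum (\<lambda>u w. (f u + f w)\<^sup>2) = 2 * (\<Sum>u\<in>V. d u * (f u)\<^sup>2) + 2 * dart_sum (\<lambda>u w. f u * f w)"
proof -
  have "dart_sum (\<lambda>u w. (f u + f w)\<^sup>2) = dart_sum (\<lambda>u w. ((f u)\<^sup>2 + (f w)\<^sup>2) + 2 * (f u * f w))"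
    by (rule dart_sum_cong) (simp add: power2_eq_square algebra_simps)
  then show ?thesis
    unfolding dart_sum_add dart_sum_cmult dart_sum_fst dart_sum_snd by simp
qed

lemma form_nonneg: "form f \<ge> 0"
  unfolding form_def by (rule dart_sum_nonneg) simp

section \<open>From edge expansion to a spectral gap\<close>

definition expanding :: "real \<Rightarrow> real \<Rightarrow> bool" where
  "expanding s \<kappa> \<longleftrightarrow> (\<forall>S. S \<noteq> {} \<and> S \<subseteq> V \<and> real (card S) \<le> s \<longrightarrow>
     \<kappa> * real (card S) \<le> dart_sum (\<lambda>u w. of_bool (u \<in> S \<and> w \<notin> S)))"

text \<open>The layer-cake formula as an induction on the size of the support: lowering
  \<open>g\<close> on its support by its least positive value strips off one level set. The factor 2
  arises because \<open>expanding\<close> counts a boundary edge in one orientation only, while the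
  right-hand side counts it in both.\<close>

lemma coarea:
  assumes exp: "expanding s \<kappa>" and "\<And>u. u \<in> V \<Longrightarrow> g u \<ge> 0"
    and "real (card {u\<in>V. g u > 0}) \<le> s"
  shows "2 * \<kappa> * (\<Sum>u\<in>V. g u) \<le> dart_sum (\<lambda>u w. \<bar>g u - g w\<bar>)"
  using assms(2,3)
proof (induction "card {u\<in>V. g u > 0}" arbitrary: g rule: less_induct)
  case (less g)
  define S where "S = {u\<in>V. g u > 0}"
  have fin: "finite S" unfolding S_def using finite_V by simp
  have SV: "S \<subseteq> V" unfolding S_def by auto
  have off: "g u = 0" if "u \<in> V" "u \<notin> S" for u
    using that less.prems(1)[of u] unfolding S_def by auto
  show ?case
  proof (cases "S = {}")
    case True
    then have "(\<Sum>u\<in>V. g u) = 0" using off by simp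
    then show ?thesis by (simp add: dart_sum_nonneg)
  next
    case False
    define m where "m = Min (g ` S)"
    have m_le: "m \<le> g u" if "u \<in> S" for u unfolding m_def using fin that by simp
    obtain u0 where u0: "u0 \<in> S" "g u0 = m"
      using Min_in[of "g ` S"] fin False unfolding m_def by fastforce
    have mpos: "m > 0" using u0 unfolding S_def by auto
    define g' where "g' = (\<lambda>u. g u - m * of_bool (u \<in> S))"
    have sub: "{u\<in>V. g' u > 0} \<subseteq> S - {u0}"
          proof
      fix u assume "u \<in> {u\<in>V. g' u > 0}"
      then have "u \<in> V" "g' u > 0" by auto
      then show "u \<in> S - {u0}" using off[of u] u0 unfolding g'_def by (cases "u \<in> S") auto
    qed
    have "card {u\<in>V. g' u > 0} \<le> card (S - {u0})" by (rule card_mono) (use fin sub in auto)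
    also have "\<dots> < card S" using fin u0 by (meson card_Diff1_less)
    finally have lt: "card {u\<in>V. g' u > 0} < card {u\<in>V. g u > 0}" unfolding S_def .
    have IH: "2 * \<kappa> * (\<Sum>u\<in>V. g' u) \<le> dart_sum (\<lambda>u w. \<bar>g' u - g' w\<bar>)"
    proof (rule less.hyps[OF lt])
      show "g' u \<ge> 0" if "u \<in> V" for u
        using m_le[of u] less.prems(1)[OF that] unfolding g'_def by (cases "u \<in> S") auto
      show "real (card {u\<in>V. g' u > 0}) \<le> s" using lt less.prems(2) by linarith
    qed
    let ?I = "\<lambda>u w. of_bool (u \<in> S \<and> w \<notin> S) :: real"
    \<comment> \<open>Two endpoints in \<open>S\<close> are lowered equally; if only one lies in
      \<open>S\<close>, the other has value 0 and the difference drops by exactly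
      \<open>m\<close>.\<close>
    have "\<bar>g u - g w\<bar> = \<bar>g' u - g' w\<bar> + m * (?I u w + ?I w u)" if "u \<in> V" "w \<in> V" for u w
      using m_le[of u] m_le[of w] off[of u] off[of w] that mpos unfolding g'_def
      by (cases "u \<in> S"; cases "w \<in> S") auto
    then have "dart_sum (\<lambda>u w. \<bar>g u - g w\<bar>)
        = dart_sum (\<lambda>u w. \<bar>g' u - g' w\<bar> + m * (?I u w + ?I w u))"
      by (intro dart_sum_cong) auto
    also have "\<dots> = dart_sum (\<lambda>u w. \<bar>g' u - g' w\<bar>) + m * (2 * dart_sum ?I)"
      unfolding dart_sum_add dart_sum_cmult using dart_sum_swap[of ?I] by simp
    finally have eq: "dart_sum (\<lambda>u w. \<bar>g u - g w\<bar>)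
        = dart_sum (\<lambda>u w. \<bar>g' u - g' w\<bar>) + m * (2 * dart_sum ?I)" .
    have "\<kappa> * card S \<le> dart_sum ?I"
      using exp[unfolded expanding_def, rule_format, of S] False SV less.prems(2)
      unfolding S_def[symmetric] by simp
    then have bd: "m * (2 * (\<kappa> * card S)) \<le> m * (2 * dart_sum ?I)"
      using mpos by simp
    have "(\<Sum>u\<in>V. of_bool (u \<in> S)) = real (card S)"
      using SV finite_V by (simp add: of_bool_def Int_absorb1 sum.If_cases)
    then have sum_g: "(\<Sum>u\<in>V. g u) = (\<Sum>u\<in>V. g' u) + m * card S"
      unfolding g'_def sum_subtractf sum_distrib_left[symmetric] by simp
    show ?thesis using IH bd unfolding eq sum_g by (simp add: algebra_simps)
  qed
qed

text \<open>Apply \<open>coarea\<close> to the square of \<open>f\<close>, factor the difference of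
  squares, and use Cauchy-Schwarz over the darts. The factor with sums \<open>f u + f w\<close> is
  at most \<open>4 * \<Delta>\<close> times the square sum.\<close>

lemma cheeger_small_support:
  assumes exp: "expanding s \<kappa>" "\<kappa> > 0" and nn: "\<And>u. u \<in> V \<Longrightarrow> f u \<ge> 0"
    and supp: "real (card {u\<in>V. f u > 0}) \<le> s" and deg: "\<And>u. u \<in> V \<Longrightarrow> d u \<le> \<Delta>"
  shows "\<kappa>\<^sup>2 * (\<Sum>u\<in>V. (f u)\<^sup>2) \<le> \<Delta> * form f"
proof -
  let ?s = "\<Sum>u\<in>V. (f u)\<^sup>2"
  have s0: "?s \<ge> 0" by (rule sum_nonneg) simp
  have "{u\<in>V. (f u)\<^sup>2 > 0} = {u\<in>V. f u > 0}" using nn by force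
  then have "2 * \<kappa> * ?s \<le> dart_sum (\<lambda>u w. \<bar>(f u)\<^sup>2 - (f w)\<^sup>2\<bar>)"
    using supp by (intro coarea[OF exp(1)]) auto
  also have "\<dots> = dart_sum (\<lambda>u w. \<bar>f u - f w\<bar> * (f u + f w))"
  proof (rule dart_sum_cong)
    fix u w assume "u \<in> V" "w \<in> V"
    have "(f u)\<^sup>2 - (f w)\<^sup>2 = (f u - f w) * (f u + f w)"
      by (simp add: power2_eq_square algebra_simps)
    then show "\<bar>(f u)\<^sup>2 - (f w)\<^sup>2\<bar> = \<bar>f u - f w\<bar> * (f u + f w)"
      using nn[OF \<open>u \<in> V\<close>] nn[OF \<open>w \<in> V\<close>] by (simp add: abs_mult)
  qed
  finally have "(2 * \<kappa> * ?s)\<^sup>2 \<le> (dart_sum (\<lambda>u w. \<bar>f u - f w\<bar> * (f u + f w)))\<^sup>2"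
    using s0 exp(2) by (intro power_mono) auto
  also have "\<dots> \<le> form f * dart_sum (\<lambda>u w. (f u + f w)\<^sup>2)"
    using Cauchy_Schwarz_ineq_sum[of "\<lambda>p. \<bar>f (fst p) - f (snd p)\<bar>" "\<lambda>p. f (fst p) + f (snd p)" "Sigma V N"]
    unfolding form_def dart_sum_def by simp
  also have "dart_sum (\<lambda>u w. (f u + f w)\<^sup>2) \<le> 4 * \<Delta> * ?s"
  proof -
    have "dart_sum (\<lambda>u w. (f u + f w)\<^sup>2) \<le> 4 * (\<Sum>u\<in>V. d u * (f u)\<^sup>2)"
      using form_nonneg[of f] unfolding dart_sum_plus_sq form_eq by simp
    also have "(\<Sum>u\<in>V. d u * (f u)\<^sup>2) \<le> (\<Sum>u\<in>V. \<Delta> * (f u)\<^sup>2)"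
      by (intro sum_mono mult_right_mono deg) auto
    finally show ?thesis by (simp add: sum_distrib_left[symmetric])
  qed
  finally have "(2 * \<kappa> * ?s)\<^sup>2 \<le> form f * (4 * \<Delta> * ?s)"
    using form_nonneg[of f] by (simp add: mult_left_mono)
  then have "?s * (\<kappa>\<^sup>2 * ?s) \<le> ?s * (\<Delta> * form f)"
    by (simp add: power2_eq_square algebra_simps)
  moreover have "\<Delta> \<ge> 0" using deg d_pos V_nonempty by (meson ex_in_conv less_imp_le order_trans)
  ultimately show ?thesis using s0 form_nonneg[of f]
    by (cases "?s = 0") (auto simp: mult_le_cancel_left)
qed

text \<open>The witness is the least value of \<open>f\<close> such that at least half of the
  vertices lie at or below it.\<close>

lemma median_exists:
  fixes f :: "'a \<Rightarrow> real"
  obtains m where "real (card {u\<in>V. f u > m}) \<le> card V / 2"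
    "real (card {u\<in>V. f u < m}) \<le> card V / 2"
proof -
  define T where "T = {t \<in> f ` V. real (card {u\<in>V. f u \<le> t}) \<ge> card V / 2}"
  have finT: "finite T" unfolding T_def using finite_V by simp
  have split: "real (card {u\<in>V. f u \<le> t}) + real (card {u\<in>V. f u > t}) = card V" for t
  proof -
    have "card V = card ({u\<in>V. f u \<le> t} \<union> {u\<in>V. f u > t})" by (rule arg_cong[of _ _ card]) auto
    also have "\<dots> = card {u\<in>V. f u \<le> t} + card {u\<in>V. f u > t}"
      by (rule card_Un_disjoint) (use finite_V in auto)
    finally show ?thesis by simp
  qed
  have "Max (f ` V) \<in> T"
  proof -
    have "{u\<in>V. f u \<le> Max (f ` V)} = V" using finite_V by auto
    then show ?thesis unfolding T_def using finite_V V_nonempty by simp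
  qed
  then have Tne: "T \<noteq> {}" by auto
  define m where "m = Min T"
  have mT: "m \<in> T" unfolding m_def using finT Tne by simp
  show ?thesis
  proof (rule that[of m])
    show "real (card {u\<in>V. f u > m}) \<le> card V / 2"
      using split[of m] mT unfolding T_def by auto
    show "real (card {u\<in>V. f u < m}) \<le> card V / 2"
    proof (cases "{u\<in>V. f u < m} = {}")
      case True
      show ?thesis unfolding True by simp
    next
      case False
      define L where "L = {u\<in>V. f u < m}"
      have finL: "finite L" "L \<noteq> {}" using finite_V False unfolding L_def by auto
      define t where "t = Max (f ` L)"
      obtain u where u: "u \<in> L" "f u = t"
        using Max_in[of "f ` L"] finL unfolding t_def by fastforce
      have "t < m" "t \<in> f ` V" using u unfolding L_def by auto
      \<comment> \<open>Here \<open>t\<close> is the largest value below \<open>m\<close>.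
        Minimality of \<open>m\<close> excludes it from \<open>T\<close>, so fewer than half of the
        vertices lie at or below \<open>t\<close>, and these are exactly the vertices below
        \<open>m\<close>.\<close>
      have "t \<notin> T" using Min_le[OF finT, of t] \<open>t < m\<close> unfolding m_def by auto
      moreover have "{u\<in>V. f u \<le> t} = L"
      proof (intro set_eqI iffI)
        fix x assume "x \<in> L"
        then show "x \<in> {u\<in>V. f u \<le> t}" using finL unfolding t_def by (auto simp: L_def)
      qed (use \<open>t < m\<close> in \<open>auto simp: L_def\<close>)
      ultimately show ?thesis using \<open>t \<in> f ` V\<close> unfolding T_def L_def by auto
    qed
  qed
qed

text \<open>Cut \<open>h\<close> at a median, so that the parts above and below are both supported
  on at most half of the vertices and \<open>cheeger_small_support\<close> applies to each.
  Recentring from the median to the weighted mean 0 only decreases the weighted square sum. One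
  factor \<open>\<Delta>\<close> comes from \<open>cheeger_small_support\<close>, the other from
  bounding the degree weights.\<close>

lemma cheeger:
  assumes exp: "expanding (card V / 2) \<kappa>" "\<kappa> > 0" and deg: "\<And>u. u \<in> V \<Longrightarrow> d u \<le> \<Delta>"
    and mean: "(\<Sum>u\<in>V. d u * h u) = 0"
  shows "\<kappa>\<^sup>2 * (\<Sum>u\<in>V. d u * (h u)\<^sup>2) \<le> \<Delta>\<^sup>2 * form h"
proof -
  obtain m where m: "real (card {u\<in>V. h u > m}) \<le> card V / 2"
    "real (card {u\<in>V. h u < m}) \<le> card V / 2"
    using median_exists by blast
  define p where "p = (\<lambda>u. max (h u - m) 0)"
  define r where "r = (\<lambda>u. max (m - h u) 0)"
  have D0: "\<Delta> \<ge> 0" using deg d_pos V_nonempty by (meson ex_in_conv less_imp_le order_trans)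
  have "{u\<in>V. p u > 0} = {u\<in>V. h u > m}" "{u\<in>V. r u > 0} = {u\<in>V. h u < m}"
    unfolding p_def r_def by auto
  then have pr: "\<kappa>\<^sup>2 * (\<Sum>u\<in>V. (p u)\<^sup>2) \<le> \<Delta> * form p" "\<kappa>\<^sup>2 * (\<Sum>u\<in>V. (r u)\<^sup>2) \<le> \<Delta> * form r"
    using m by (auto intro!: cheeger_small_support[OF exp _ _ deg] simp: p_def r_def)
  have "form p + form r \<le> form h"
    unfolding form_def dart_sum_add[symmetric]
  proof (rule dart_sum_mono)
    fix u w
    have eq: "h u - h w = (p u - p w) - (r u - r w)" unfolding p_def r_def by simp
    \<comment> \<open>At every vertex \<open>p\<close> or \<open>r\<close> vanishes, so the product
      is \<open>- (p u * r w + p w * r u)\<close>.\<close>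
    moreover have "(p u - p w) * (r u - r w) \<le> 0"
      unfolding p_def r_def by (cases "h u \<le> m"; cases "h w \<le> m")
        (auto simp: max_def mult_le_0_iff)
    moreover have "(h u - h w)\<^sup>2
        = (p u - p w)\<^sup>2 + (r u - r w)\<^sup>2 - 2 * ((p u - p w) * (r u - r w))"
      unfolding eq by (simp add: power2_eq_square algebra_simps)
    ultimately show "(p u - p w)\<^sup>2 + (r u - r w)\<^sup>2 \<le> (h u - h w)\<^sup>2"
      by linarith
  qed
  then have fm: "\<Delta> * (form p + form r) \<le> \<Delta> * form h" using D0 by (rule mult_left_mono)
  have "(\<Sum>u\<in>V. (h u - m)\<^sup>2) = (\<Sum>u\<in>V. (p u)\<^sup>2 + (r u)\<^sup>2)"
    by (rule sum.cong) (auto simp: p_def r_def max_def power2_commute)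
  then have 1: "\<kappa>\<^sup>2 * (\<Sum>u\<in>V. (h u - m)\<^sup>2) \<le> \<Delta> * form h"
    using pr fm by (simp add: sum.distrib distrib_left)
  have "(\<Sum>u\<in>V. d u * (h u - m)\<^sup>2)
      = (\<Sum>u\<in>V. d u * (h u)\<^sup>2 - 2 * m * (d u * h u) + m\<^sup>2 * d u)"
    by (rule sum.cong) (auto simp: power2_eq_square algebra_simps)
  also have "\<dots> = (\<Sum>u\<in>V. d u * (h u)\<^sup>2) + m\<^sup>2 * (\<Sum>u\<in>V. d u)"
    unfolding sum.distrib sum_subtractf sum_distrib_left[symmetric] mean by simp
  finally have "(\<Sum>u\<in>V. d u * (h u)\<^sup>2) \<le> (\<Sum>u\<in>V. d u * (h u - m)\<^sup>2)"
    using d_pos by (simp add: sum_nonneg less_imp_le)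
  also have "\<dots> \<le> (\<Sum>u\<in>V. \<Delta> * (h u - m)\<^sup>2)"
    by (intro sum_mono mult_right_mono deg) auto
  finally have "\<kappa>\<^sup>2 * (\<Sum>u\<in>V. d u * (h u)\<^sup>2) \<le> \<kappa>\<^sup>2 * (\<Delta> * (\<Sum>u\<in>V. (h u - m)\<^sup>2))"
    by (intro mult_left_mono) (auto simp: sum_distrib_left)
  also have "\<dots> \<le> \<Delta> * (\<Delta> * form h)"
    using mult_left_mono[OF 1 D0] by (simp add: algebra_simps)
  finally show ?thesis by (simp add: power2_eq_square algebra_simps)
qed

subsection \<open>Tilted transition operators\<close>

definition avg :: "('a \<Rightarrow> real) \<Rightarrow> 'a \<Rightarrow> real" where
  "avg f u = (\<Sum>w\<in>N u. f w) / d u"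

text \<open>
  For \<open>r = 1\<close> this is the transition operator of the lazy walk. For \<open>r = q\<close> at \<open>v\<close> and \<open>1\<close> elsewhere,
  its \<open>k\<close>-th iterate maps \<open>1\<close> to the expectation of \<open>q\<close> to the number of exits from \<open>v\<close> in \<open>k\<close> steps.
\<close>

definition tilt_op :: "('a \<Rightarrow> real) \<Rightarrow> ('a \<Rightarrow> real) \<Rightarrow> 'a \<Rightarrow> real" where
  "tilt_op r f u = f u / 2 + r u / 2 * avg f u"

text \<open>The weight \<open>d / r\<close> makes \<open>tilt_op r\<close> self-adjoint.\<close>

definition ip :: "('a \<Rightarrow> real) \<Rightarrow> ('a \<Rightarrow> real) \<Rightarrow> ('a \<Rightarrow> real) \<Rightarrow> real" where
  "ip r f g = (\<Sum>u\<in>V. d u / r u * f u * g u)"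

lemma ip_commute: "ip r f g = ip r g f"
  unfolding ip_def by (simp add: mult.commute mult.left_commute)

lemma ip_diff_cmult_left: "ip r (\<lambda>u. c * f u - g u) k = c * ip r f k - ip r g k"
  unfolding ip_def by (simp add: sum_distrib_left sum_subtractf[symmetric] algebra_simps)

lemma ip_diff_cmult_right: "ip r k (\<lambda>u. c * f u - g u) = c * ip r k f - ip r k g"
  using ip_diff_cmult_left[of r c f g k] by (simp add: ip_commute[of r k])

lemma tilt_op_diff_cmult: "tilt_op r (\<lambda>u. c * f u - g u) = (\<lambda>u. c * tilt_op r f u - tilt_op r g u)"
  unfolding tilt_op_def avg_def
  by (auto simp: fun_eq_iff sum_subtractf sum_distrib_left[symmetric] diff_divide_distrib algebra_simps)

context
  fixes r :: "'a \<Rightarrow> real"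
  assumes r_pos: "\<And>u. u \<in> V \<Longrightarrow> 0 < r u" and r_le_1: "\<And>u. u \<in> V \<Longrightarrow> r u \<le> 1"
begin

text \<open>The weight \<open>d u / r u\<close> cancels the factor \<open>r u / d u\<close> of the
  moving part. What remains of that part is independent of \<open>r\<close> and symmetric under
  reversing darts, whence self-adjointness.\<close>

lemma ip_tilt_op:
  "ip r f (tilt_op r g) = (ip r f g + dart_sum (\<lambda>u w. f u * g w)) / 2"
proof -
  have "ip r f (tilt_op r g) = (\<Sum>u\<in>V. d u / r u * f u * g u / 2 + (\<Sum>w\<in>N u. f u * g w) / 2)"
    unfolding ip_def tilt_op_def avg_def
  proof (rule sum.cong[OF refl])
    fix u assume "u \<in> V"
    then have "r u > 0" "d u > 0" using r_pos d_pos by auto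
    then show "d u / r u * f u * (g u / 2 + r u / 2 * ((\<Sum>w\<in>N u. g w) / d u))
        = d u / r u * f u * g u / 2 + (\<Sum>w\<in>N u. f u * g w) / 2"
      by (simp add: field_simps sum_distrib_left[symmetric])
  qed
  then show ?thesis
    unfolding ip_def dart_sum_eq sum.distrib sum_divide_distrib[symmetric] by (simp add: add_divide_distrib)
qed

lemma ip_selfadjoint:
  "ip r (tilt_op r f) g = ip r f (tilt_op r g)"
  using ip_tilt_op[of f g] ip_tilt_op[of g f] ip_commute[of r f g]
    ip_commute[of r "tilt_op r f" g] dart_sum_swap[of "\<lambda>u w. f u * g w"]
  by (simp add: mult.commute)

lemma ip_ge_ip_one:
  "(\<Sum>u\<in>V. d u * (f u)\<^sup>2) \<le> ip r f f"
  unfolding ip_def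
proof (rule sum_mono)
  fix u assume u: "u \<in> V"
  have "d u \<le> d u / r u"
    using r_pos[OF u] r_le_1[OF u] d_pos[OF u] by (simp add: field_simps)
  from mult_right_mono[OF this, of "(f u)\<^sup>2"]
  show "d u * (f u)\<^sup>2 \<le> d u / r u * f u * f u" by (simp add: power2_eq_square mult.assoc)
qed

text \<open>Laziness makes the operator positive semidefinite.\<close>

lemma ip_tilt_op_nonneg:
  "ip r f (tilt_op r f) \<ge> 0"
proof -
  have "0 \<le> dart_sum (\<lambda>u w. (f u + f w)\<^sup>2)" by (rule dart_sum_nonneg) simp
  then show ?thesis
    using ip_ge_ip_one[of f] unfolding ip_tilt_op dart_sum_plus_sq by simp
qed

text \<open>Turns lower bounds on the Dirichlet form into upper bounds on Rayleigh quotients. The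
  second summand is the loss due to the tilt and vanishes for \<open>r = 1\<close>.\<close>

lemma ip_minus_tilt_op:
  "ip r f f - ip r f (tilt_op r f)
    = form f / 4 + (ip r f f - (\<Sum>u\<in>V. d u * (f u)\<^sup>2)) / 2"
  unfolding ip_tilt_op form_eq by (simp add: field_simps)

text \<open>
  With \<open>p = Q f\<close>, positivity of \<open>\<langle>g, Q g\<rangle>\<close> at \<open>g = \<lambda> f - p\<close> turns the bound on the Rayleigh
  quotients of \<open>f\<close> and \<open>p\<close> into \<open>\<parallel>p\<parallel> \<le> \<lambda> \<parallel>f\<parallel>\<close>, with no loss in \<open>\<lambda>\<close>.
\<close>

lemma tilt_op_contraction:
  assumes l: "l > 0"
    and f: "ip r f (tilt_op r f) \<le> l * ip r f f"
    and p: "ip r (tilt_op r f) (tilt_op r (tilt_op r f)) \<le> l * ip r (tilt_op r f) (tilt_op r f)"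
  shows "ip r (tilt_op r f) (tilt_op r f) \<le> l\<^sup>2 * ip r f f"
proof -
  let ?p = "tilt_op r f"
  have fr: "ip r f (tilt_op r ?p) = ip r ?p ?p" using ip_selfadjoint by simp
  have "0 \<le> ip r (\<lambda>u. l * f u - ?p u) (tilt_op r (\<lambda>u. l * f u - ?p u))"
    by (rule ip_tilt_op_nonneg)
  also have "\<dots> = l\<^sup>2 * ip r f ?p - 2 * l * ip r ?p ?p + ip r ?p (tilt_op r ?p)"
    unfolding tilt_op_diff_cmult ip_diff_cmult_left ip_diff_cmult_right fr
    by (simp add: power2_eq_square algebra_simps)
  also have "\<dots> \<le> l\<^sup>2 * (l * ip r f f) - 2 * l * ip r ?p ?p + l * ip r ?p ?p"
    using f p l by (intro add_mono diff_mono mult_left_mono) auto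
  finally have "l * ip r ?p ?p \<le> l * (l\<^sup>2 * ip r f f)" by (simp add: algebra_simps)
  then show ?thesis using l by (simp add: mult_le_cancel_left)
qed

text \<open>The predicate \<open>P\<close> is an invariant class of functions: mean-zero functions
  for the untilted operator, all functions for the tilted one.\<close>

lemma tilt_op_funpow_contraction:
  assumes l: "l > 0"
    and inv: "\<And>g. P g \<Longrightarrow> P (tilt_op r g)"
    and ray: "\<And>g. P g \<Longrightarrow> ip r g (tilt_op r g) \<le> l * ip r g g"
    and f: "P f"
  shows "ip r ((tilt_op r ^^ k) f) ((tilt_op r ^^ k) f) \<le> (l ^ k)\<^sup>2 * ip r f f"
proof -
  have P: "P ((tilt_op r ^^ k) f)" for k by (induction k) (auto intro: inv f)
  show ?thesis
  proof (induction k)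
    case (Suc k)
    let ?g = "(tilt_op r ^^ k) f"
    have "ip r (tilt_op r ?g) (tilt_op r ?g) \<le> l\<^sup>2 * ip r ?g ?g"
      by (rule tilt_op_contraction[OF l ray[OF P] ray[OF inv[OF P]]])
    also have "\<dots> \<le> l\<^sup>2 * ((l ^ k)\<^sup>2 * ip r f f)" by (rule mult_left_mono[OF Suc]) simp
    finally show ?case by (simp add: power_mult_distrib mult.assoc)
  qed simp
qed

end

section \<open>Mixing of the untilted lazy walk\<close>

definition vol :: real where "vol = (\<Sum>u\<in>V. d u)"

lemma vol_pos: "vol > 0"
  unfolding vol_def using finite_V V_nonempty d_pos by (intro sum_pos) auto

abbreviation P :: "('a \<Rightarrow> real) \<Rightarrow> 'a \<Rightarrow> real" where "P \<equiv> tilt_op (\<lambda>_. 1)"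

lemma ip_one: "ip (\<lambda>_. 1) f f = (\<Sum>u\<in>V. d u * (f u)\<^sup>2)"
  unfolding ip_def by (simp add: power2_eq_square mult.assoc)

text \<open>Stationarity of the degree measure; it makes the mean-zero functions an invariant
  class.\<close>

lemma sum_P: "(\<Sum>u\<in>V. d u * P f u) = (\<Sum>u\<in>V. d u * f u)"
  using ip_tilt_op[of "\<lambda>_. 1" "\<lambda>_. 1" f] unfolding ip_def dart_sum_snd by simp

lemma P_pow_const_add:
  assumes "u \<in> V"
  shows "(P ^^ k) (\<lambda>u. a + h u) u = a + (P ^^ k) h u"
  using assms
proof (induction k arbitrary: u)
  case (Suc k)
  have "(\<Sum>w\<in>N u. (P ^^ k) (\<lambda>u. a + h u) w) = (\<Sum>w\<in>N u. a + (P ^^ k) h w)"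
    using Suc N_in by (intro sum.cong) auto
  also have "\<dots> = d u * a + (\<Sum>w\<in>N u. (P ^^ k) h w)" by (simp add: sum.distrib d_def)
  finally show ?case
    using Suc.IH[OF Suc.prems] d_pos[OF Suc.prems] unfolding funpow.simps comp_def
    by (simp add: tilt_op_def[of _ "(P ^^ k) _"] avg_def field_simps)
qed simp

text \<open>Split \<open>f\<close> into its mean and a mean-zero part. The mean is fixed by the walk
  and bounded through Pythagoras, giving \<open>1 / sqrt vol\<close>; the rest contracts by
  \<open>1 - g / 4\<close> per step.\<close>

lemma P_mixing:
  assumes gap: "\<And>h. (\<Sum>u\<in>V. d u * h u) = 0 \<Longrightarrow> g * (\<Sum>u\<in>V. d u * (h u)\<^sup>2) \<le> form h"
    and g: "g < 4" and u: "u \<in> V"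
  shows "(P ^^ k) f u
    \<le> sqrt (\<Sum>u\<in>V. d u * (f u)\<^sup>2) * (1 / sqrt vol + (1 - g / 4) ^ k / sqrt (d u))"
proof -
  define a where "a = (\<Sum>u\<in>V. d u * f u) / vol"
  define h where "h = (\<lambda>u. f u - a)"
  define F where "F = (\<Sum>u\<in>V. d u * (f u)\<^sup>2)"
  define H where "H = (\<Sum>u\<in>V. d u * (h u)\<^sup>2)"
  let ?l = "1 - g / 4"
  have mean: "(\<Sum>u\<in>V. d u * h u) = 0"
  proof -
    have "(\<Sum>u\<in>V. d u * h u) = (\<Sum>u\<in>V. d u * f u) - vol * a"
      unfolding h_def vol_def right_diff_distrib sum_subtractf sum_distrib_right ..
    then show ?thesis using vol_pos unfolding a_def by simp
  qed
  have "F = (\<Sum>u\<in>V. d u * (h u)\<^sup>2 + a\<^sup>2 * d u + 2 * a * (d u * h u))"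
    unfolding F_def h_def by (rule sum.cong) (auto simp: power2_eq_square algebra_simps)
  also have "\<dots> = H + a\<^sup>2 * vol"
    unfolding sum.distrib sum_distrib_left[symmetric] mean H_def vol_def by simp
  finally have F: "F = H + a\<^sup>2 * vol" .
  have H0: "H \<ge> 0" unfolding H_def using d_pos
    by (intro sum_nonneg mult_nonneg_nonneg) (auto intro: less_imp_le)
  have "ip (\<lambda>_. 1) ((P ^^ k) h) ((P ^^ k) h) \<le> (?l ^ k)\<^sup>2 * ip (\<lambda>_. 1) h h"
  proof (rule tilt_op_funpow_contraction[where P = "\<lambda>h. (\<Sum>u\<in>V. d u * h u) = 0"])
    fix h assume "(\<Sum>u\<in>V. d u * h u) = 0"
    from gap[OF this] show "ip (\<lambda>_. 1) h (P h) \<le> ?l * ip (\<lambda>_. 1) h h"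
      using ip_minus_tilt_op[of "\<lambda>_. 1" h] unfolding ip_one by (simp add: algebra_simps)
  qed (use g mean in \<open>auto simp: sum_P\<close>)
  then have "(\<Sum>w\<in>V. d w * ((P ^^ k) h w)\<^sup>2) \<le> (?l ^ k)\<^sup>2 * H" unfolding ip_one H_def .
  \<comment> \<open>Keeping one term of the norm gives the pointwise bound, at the cost of
    \<open>1 / sqrt (d u)\<close>.\<close>
  moreover have "d u * ((P ^^ k) h u)\<^sup>2 \<le> (\<Sum>w\<in>V. d w * ((P ^^ k) h w)\<^sup>2)"
    using u finite_V d_pos by (intro member_le_sum mult_nonneg_nonneg) (auto intro: less_imp_le)
  moreover have "(?l ^ k)\<^sup>2 * H \<le> (?l ^ k)\<^sup>2 * F"
    using F vol_pos by (intro mult_left_mono) auto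
  ultimately have "d u * ((P ^^ k) h u)\<^sup>2 \<le> (?l ^ k)\<^sup>2 * F" by linarith
  then have "sqrt (d u * ((P ^^ k) h u)\<^sup>2) \<le> sqrt ((?l ^ k)\<^sup>2 * F)" by simp
  then have *: "sqrt (d u) * \<bar>(P ^^ k) h u\<bar> \<le> ?l ^ k * sqrt F"
    using g by (simp add: real_sqrt_mult)
  then have 1: "(P ^^ k) h u \<le> sqrt F * (?l ^ k / sqrt (d u))"
  proof -
    have "(P ^^ k) h u \<le> \<bar>(P ^^ k) h u\<bar>" by simp
    also have "\<dots> \<le> ?l ^ k * sqrt F / sqrt (d u)"
      using * d_pos[OF u] by (simp add: pos_le_divide_eq mult.commute)
    finally show ?thesis by (simp add: mult.commute)
  qed
  have "a\<^sup>2 * vol \<le> F" using F H0 by simp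
  then have "sqrt (a\<^sup>2 * vol) \<le> sqrt F" by simp
  then have 2: "a \<le> sqrt F * (1 / sqrt vol)"
  proof -
    have "\<bar>a\<bar> \<le> sqrt F / sqrt vol"
      using \<open>sqrt (a\<^sup>2 * vol) \<le> sqrt F\<close> vol_pos by (simp add: real_sqrt_mult pos_le_divide_eq)
    then show ?thesis by simp
  qed
  have "(P ^^ k) f u = a + (P ^^ k) h u"
    using P_pow_const_add[OF u, of k a h] unfolding h_def by simp
  then show ?thesis using 1 2 unfolding F_def by (simp add: distrib_left)
qed

section \<open>Monotonicity and comparison with the untilted operator\<close>

lemma avg_mono: "u \<in> V \<Longrightarrow> (\<And>w. w \<in> V \<Longrightarrow> f w \<le> g w) \<Longrightarrow> avg f u \<le> avg g u"
  unfolding avg_def using d_pos N_in by (intro divide_right_mono sum_mono) (auto intro: less_imp_le)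

lemma avg_nonneg: "u \<in> V \<Longrightarrow> (\<And>w. w \<in> V \<Longrightarrow> 0 \<le> g w) \<Longrightarrow> 0 \<le> avg g u"
  using avg_mono[of u "\<lambda>_. 0" g] by (simp add: avg_def)

lemma P_mono: "u \<in> V \<Longrightarrow> (\<And>w. w \<in> V \<Longrightarrow> f w \<le> g w) \<Longrightarrow> P f u \<le> P g u"
  unfolding tilt_op_def using avg_mono[of u f g] by (simp add: add_mono)

lemma tilt_op_nonneg:
  "u \<in> V \<Longrightarrow> (\<And>w. w \<in> V \<Longrightarrow> 0 \<le> r w) \<Longrightarrow> (\<And>w. w \<in> V \<Longrightarrow> 0 \<le> g w) \<Longrightarrow> 0 \<le> tilt_op r g u"
  unfolding tilt_op_def using avg_nonneg[of u g] by simp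

lemma tilt_op_pow_nonneg:
  "u \<in> V \<Longrightarrow> (\<And>w. w \<in> V \<Longrightarrow> 0 \<le> r w) \<Longrightarrow> (\<And>w. w \<in> V \<Longrightarrow> 0 \<le> g w) \<Longrightarrow> 0 \<le> (tilt_op r ^^ k) g u"
  by (induction k arbitrary: u) (auto intro!: tilt_op_nonneg)

lemma tilt_op_pow_le_P_pow:
  assumes "u \<in> V" "\<And>w. w \<in> V \<Longrightarrow> 0 \<le> r w" "\<And>w. w \<in> V \<Longrightarrow> r w \<le> 1" "\<And>w. w \<in> V \<Longrightarrow> 0 \<le> g w"
  shows "(tilt_op r ^^ k) g u \<le> (P ^^ k) g u"
  using assms(1)
proof (induction k arbitrary: u)
  case (Suc k)
  have "tilt_op r ((tilt_op r ^^ k) g) u \<le> P ((tilt_op r ^^ k) g) u"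
    unfolding tilt_op_def[of _ "(tilt_op r ^^ k) g"]
    using mult_right_mono[OF assms(3)[OF Suc.prems] avg_nonneg[OF Suc.prems], of "(tilt_op r ^^ k) g"]
      tilt_op_pow_nonneg[of _ r g k] assms(2,4) by simp
  also have "\<dots> \<le> P ((P ^^ k) g) u" by (rule P_mono[OF Suc.prems Suc.IH])
  finally show ?case by simp
qed simp

section \<open>The operator tilted at a single vertex\<close>

definition exit_weight :: "real \<Rightarrow> 'a \<Rightarrow> 'a \<Rightarrow> real" where
  "exit_weight q v u = (if u = v then q else 1)"

lemma ip_exit_weight:
  assumes "v \<in> V" "q > 0"
  shows "ip (exit_weight q v) f f = (\<Sum>u\<in>V. d u * (f u)\<^sup>2) + (1 / q - 1) * d v * (f v)\<^sup>2"
proof -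
  have "ip (exit_weight q v) f f
      = (\<Sum>u\<in>V. d u * (f u)\<^sup>2 + (if u = v then (1 / q - 1) * d v * (f v)\<^sup>2 else 0))"
    unfolding ip_def exit_weight_def
    by (rule sum.cong) (auto simp: power2_eq_square algebra_simps)
  then show ?thesis using assms finite_V by (simp add: sum.distrib)
qed

lemma form_ge_star:
  assumes v: "v \<in> V"
  shows "2 * (\<Sum>w\<in>N v. (f v - f w)\<^sup>2) \<le> form f"
proof -
  let ?I = "\<lambda>u w. of_bool (u = v) * (f u - f w)\<^sup>2"
  have "dart_sum ?I = (\<Sum>u\<in>V. if u = v then \<Sum>w\<in>N v. (f v - f w)\<^sup>2 else 0)"
    unfolding dart_sum_eq by (rule sum.cong) auto
  also have "\<dots> = (\<Sum>w\<in>N v. (f v - f w)\<^sup>2)" using v finite_V by simp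
  finally have 1: "dart_sum ?I = (\<Sum>w\<in>N v. (f v - f w)\<^sup>2)" .
  have "dart_sum (\<lambda>u w. ?I u w + ?I w u) \<le> form f"
    unfolding form_def by (rule dart_sum_mono) (auto simp: power2_commute)
  then show ?thesis unfolding dart_sum_add using dart_sum_swap[of ?I] 1 by simp
qed

text \<open>
  Split \<open>f = a + h\<close> with \<open>a\<close> the mean. The spectral gap pays for \<open>h\<close>; since \<open>v\<close> has many neighbours, the
  values of \<open>h\<close> on them are small on average, so the edges at \<open>v\<close> contribute almost \<open>d v * (f v - a)\<^sup>2\<close>.
\<close>

lemma rayleigh_exit_weight:
  assumes v: "v \<in> V" and q: "0 < q" "q < 1" and \<tau>: "0 < \<tau>" "\<tau> < 1" and g: "g > 0"
    and gap: "\<And>h. (\<Sum>u\<in>V. d u * h u) = 0 \<Longrightarrow> g * (\<Sum>u\<in>V. d u * (h u)\<^sup>2) \<le> form h"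
    and \<delta>: "\<delta> > 0" "\<And>u. u \<in> V \<Longrightarrow> \<delta> \<le> d u" "4 * (1 / \<tau> - 1) \<le> \<tau> * g * \<delta>"
    and \<kappa>: "\<kappa> \<le> \<tau> / 2" "\<kappa> \<le> (1 - \<tau>) * \<tau> * g / 8" "2 * \<kappa> * vol \<le> (1 - \<tau>) ^ 3 * (1 - q) * d v"
  shows "ip (exit_weight q v) f (tilt_op (exit_weight q v) f)
    \<le> (1 - \<kappa>) * ip (exit_weight q v) f f"
proof -
  define a where "a = (\<Sum>u\<in>V. d u * f u) / vol"
  define h where "h = (\<lambda>u. f u - a)"
  define H where "H = (\<Sum>u\<in>V. d u * (h u)\<^sup>2)"
  define x where "x = f v"
  define c where "c = 1 / q - 1"
  define S where "S = (\<Sum>w\<in>N v. (f v - f w)\<^sup>2)"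
  have mean: "(\<Sum>u\<in>V. d u * h u) = 0"
  proof -
    have "(\<Sum>u\<in>V. d u * h u) = (\<Sum>u\<in>V. d u * f u) - vol * a"
      unfolding h_def vol_def right_diff_distrib sum_subtractf sum_distrib_right ..
    then show ?thesis using vol_pos unfolding a_def by simp
  qed
  have "(\<Sum>u\<in>V. d u * (f u)\<^sup>2) = (\<Sum>u\<in>V. d u * (h u)\<^sup>2 + a\<^sup>2 * d u + 2 * a * (d u * h u))"
    unfolding h_def by (rule sum.cong) (auto simp: power2_eq_square algebra_simps)
  also have "\<dots> = H + a\<^sup>2 * vol"
    unfolding sum.distrib sum_distrib_left[symmetric] mean H_def vol_def by simp
  finally have F: "(\<Sum>u\<in>V. d u * (f u)\<^sup>2) = H + a\<^sup>2 * vol" .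
  have H0: "H \<ge> 0" unfolding H_def using d_pos
    by (intro sum_nonneg mult_nonneg_nonneg) (auto intro: less_imp_le)
  have c0: "c > 0" unfolding c_def using q by simp
  have "form h = form f" unfolding form_def h_def by simp
  then have gH: "g * H \<le> form f" using gap[OF mean] unfolding H_def by simp

  have hN: "(\<Sum>w\<in>N v. (h w)\<^sup>2) \<le> H / \<delta>"
  proof -
    have "\<delta> * (\<Sum>w\<in>N v. (h w)\<^sup>2) \<le> (\<Sum>w\<in>N v. d w * (h w)\<^sup>2)"
      unfolding sum_distrib_left using N_in[OF v] \<delta>(2) by (intro sum_mono mult_right_mono) auto
    also have "\<dots> \<le> H" unfolding H_def
      using N_subset[OF v] finite_V d_pos by (intro sum_mono2 mult_nonneg_nonneg) (auto intro: less_imp_le)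
    finally show ?thesis using \<delta>(1) by (simp add: field_simps)
  qed
  have "(1 - \<tau>) * (d v * (x - a)\<^sup>2) - (1 / \<tau> - 1) * (\<Sum>w\<in>N v. (h w)\<^sup>2)
      = (\<Sum>w\<in>N v. (1 - \<tau>) * (x - a)\<^sup>2 - (1 / \<tau> - 1) * (h w)\<^sup>2)"
    unfolding sum_subtractf sum_distrib_left[symmetric] by (simp add: d_def)
  also have "\<dots> \<le> S" unfolding S_def
  proof (rule sum_mono)
    fix w
    \<comment> \<open>Young's inequality with parameter \<open>\<tau>\<close>, applied to
      \<open>f v - f w = (x - a) - h w\<close>.\<close>
    have "(f v - f w)\<^sup>2 - ((1 - \<tau>) * (x - a)\<^sup>2 - (1 / \<tau> - 1) * (h w)\<^sup>2)
        = \<tau> * ((x - a) - h w / \<tau>)\<^sup>2"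
      unfolding h_def x_def using \<tau> by (simp add: field_simps power2_eq_square)
    moreover have "\<dots> \<ge> 0" using \<tau> by simp
    ultimately show "(1 - \<tau>) * (x - a)\<^sup>2 - (1 / \<tau> - 1) * (h w)\<^sup>2 \<le> (f v - f w)\<^sup>2" by linarith
  qed
  finally have S1: "(1 - \<tau>) * (d v * (x - a)\<^sup>2) - (1 / \<tau> - 1) * (\<Sum>w\<in>N v. (h w)\<^sup>2) \<le> S" .
  have "(1 / \<tau> - 1) * (\<Sum>w\<in>N v. (h w)\<^sup>2) \<le> (1 / \<tau> - 1) * (H / \<delta>)"
    using hN \<tau> by (intro mult_left_mono) auto
  also have "\<dots> \<le> (\<tau> * g * \<delta> / 4) * (H / \<delta>)"
    using \<delta> H0 by (intro mult_right_mono) auto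
  also have "\<dots> = \<tau> * g / 4 * H" using \<delta>(1) by simp
  finally have S2: "(1 - \<tau>) * (d v * (x - a)\<^sup>2) - \<tau> * g / 4 * H \<le> S" using S1 by linarith

  \<comment> \<open>Write \<open>form f\<close> as
    \<open>(1 - \<tau>) * form f + \<tau> * form f\<close>. The first share pays for the edges at
    \<open>v\<close>, the second for \<open>H\<close>; the spectral gap share also absorbs the error
    left by Young's inequality.\<close>
  have "(1 - \<tau>) * (2 * ((1 - \<tau>) * (d v * (x - a)\<^sup>2) - \<tau> * g / 4 * H)) \<le> (1 - \<tau>) * form f"
  proof (rule mult_left_mono)
    have "2 * S \<le> form f" using form_ge_star[OF v, of f] unfolding S_def .
    then show "2 * ((1 - \<tau>) * (d v * (x - a)\<^sup>2) - \<tau> * g / 4 * H) \<le> form f"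
      using mult_left_mono[OF S2, of 2] by (meson order_trans zero_le_numeral)
  qed (use \<tau> in simp)
  moreover have "\<tau> * (g * H) \<le> \<tau> * form f" using gH \<tau> by simp
  moreover have "0 \<le> \<tau> * (\<tau> * g / 4 * H)" using \<tau> g H0 by simp
  ultimately have fm: "2 * (1 - \<tau>)\<^sup>2 * (d v * (x - a)\<^sup>2) + \<tau> * g / 2 * H \<le> form f"
    by (simp add: power2_eq_square algebra_simps diff_divide_distrib)

  \<comment> \<open>Minimise the right-hand side over \<open>x\<close>: the minimum is at
    \<open>x = a * q\<close> and equals \<open>(1 - q) * a\<^sup>2\<close>. This is the source of
    the factor \<open>1 - q\<close> in the decay rate.\<close>
  have quad: "(1 - q) * a\<^sup>2 \<le> (x - a)\<^sup>2 + c * x\<^sup>2"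
  proof -
    have "(x - a)\<^sup>2 + c * x\<^sup>2 - (1 - q) * a\<^sup>2 = (x - a * q)\<^sup>2 / q"
      unfolding c_def using q by (simp add: field_simps power2_eq_square)
    moreover have "\<dots> \<ge> 0" using q by simp
    ultimately show ?thesis by linarith
  qed
  have cdx: "c * d v * x\<^sup>2 \<ge> 0" using c0 d_pos[OF v] by simp
  define A where "A = d v * (x - a)\<^sup>2"
  define B where "B = c * d v * x\<^sup>2"
  have AB: "(1 - q) * d v * a\<^sup>2 \<le> A + B"
    using mult_left_mono[OF quad, of "d v"] d_pos[OF v] unfolding A_def B_def
    by (simp add: algebra_simps)
  have B0: "B \<ge> 0" using cdx unfolding B_def .
  \<comment> \<open>The norm consists of the mean, the fluctuation and the extra weight at
    \<open>v\<close>; each of the three bounds on \<open>\<kappa>\<close> controls one of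
    them.\<close>
  have "\<kappa> * ip (exit_weight q v) f f = \<kappa> * vol * a\<^sup>2 + \<kappa> * H + \<kappa> * B"
    unfolding ip_exit_weight[OF v q(1)] F B_def c_def x_def by (simp add: algebra_simps)
  also have "\<dots> \<le> (1 - \<tau>) ^ 3 / 2 * ((1 - q) * d v * a\<^sup>2) + (1 - \<tau>) * \<tau> * g / 8 * H + \<tau> / 2 * B"
  proof (intro add_mono)
    show "\<kappa> * vol * a\<^sup>2 \<le> (1 - \<tau>) ^ 3 / 2 * ((1 - q) * d v * a\<^sup>2)"
      using mult_right_mono[OF \<kappa>(3), of "a\<^sup>2 / 2"] by (simp add: mult_ac)
    show "\<kappa> * H \<le> (1 - \<tau>) * \<tau> * g / 8 * H" by (rule mult_right_mono[OF \<kappa>(2) H0])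
    show "\<kappa> * B \<le> \<tau> / 2 * B" by (rule mult_right_mono[OF \<kappa>(1) B0])
  qed
  also have "\<dots> \<le> (1 - \<tau>) ^ 3 / 2 * (A + B) + (1 - \<tau>) * \<tau> * g / 8 * H + \<tau> / 2 * B"
    using AB \<tau> by (intro add_right_mono mult_left_mono) auto
  \<comment> \<open>The third factor \<open>1 - \<tau>\<close> is held back so that the separate
    term \<open>\<tau> / 2 * B\<close> still fits into \<open>B / 2\<close>.\<close>
  also have "\<dots> \<le> (1 - \<tau>) * (form f / 4 + B / 2) + \<tau> / 2 * B"
  proof -
    have "(1 - \<tau>)\<^sup>2 * B \<le> 1 * B"
      using \<tau> B0 by (intro mult_right_mono) (auto simp: power_le_one)
    then have "(1 - \<tau>)\<^sup>2 / 2 * (A + B) + \<tau> * g / 8 * H \<le> form f / 4 + B / 2"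
      using fm unfolding A_def by (simp add: algebra_simps)
    then have "(1 - \<tau>) * ((1 - \<tau>)\<^sup>2 / 2 * (A + B) + \<tau> * g / 8 * H) \<le> (1 - \<tau>) * (form f / 4 + B / 2)"
      using \<tau> by (intro mult_left_mono) auto
    then show ?thesis by (simp add: power3_eq_cube power2_eq_square distrib_left mult.assoc)
  qed
  also have "\<dots> \<le> form f / 4 + B / 2"
    using mult_nonneg_nonneg[OF less_imp_le[OF \<tau>(1)] form_nonneg[of f]] by (simp add: algebra_simps diff_divide_distrib)
  also have "\<dots> = ip (exit_weight q v) f f - ip (exit_weight q v) f (tilt_op (exit_weight q v) f)"
  proof -
    have "ip (exit_weight q v) f f - ip (exit_weight q v) f (tilt_op (exit_weight q v) f)
        = form f / 4 + (ip (exit_weight q v) f f - (\<Sum>u\<in>V. d u * (f u)\<^sup>2)) / 2"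
      by (rule ip_minus_tilt_op) (use q in \<open>auto simp: exit_weight_def\<close>)
    then show ?thesis
      unfolding ip_exit_weight[OF v q(1)] B_def c_def x_def by simp
  qed
  finally show ?thesis by (simp add: algebra_simps)
qed

text \<open>The outer \<open>P\<close> is the first step of the walk, since a departure at time 0 is
  not counted. The innermost \<open>j\<close> operators are bounded in norm, giving a factor
  \<open>sqrt vol\<close>; the outer \<open>k\<close> are replaced by untilted ones, and mixing
  divides by \<open>sqrt vol\<close> again.\<close>

lemma exit_weight_decay:
  assumes v: "v \<in> V" and q: "0 < q" "q < 1" and \<tau>: "0 < \<tau>" "\<tau> < 1" and g: "0 < g" "g < 4"
    and gap: "\<And>h. (\<Sum>u\<in>V. d u * h u) = 0 \<Longrightarrow> g * (\<Sum>u\<in>V. d u * (h u)\<^sup>2) \<le> form h"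
    and \<delta>: "\<delta> > 0" "\<And>u. u \<in> V \<Longrightarrow> \<delta> \<le> d u" "4 * (1 / \<tau> - 1) \<le> \<tau> * g * \<delta>"
    and \<kappa>: "\<kappa> \<le> \<tau> / 2" "\<kappa> \<le> (1 - \<tau>) * \<tau> * g / 8" "2 * \<kappa> * vol \<le> (1 - \<tau>) ^ 3 * (1 - q) * d v"
    and u: "u \<in> V"
  shows "P ((tilt_op (exit_weight q v) ^^ (k + j)) (\<lambda>_. 1)) u
    \<le> (1 - \<kappa>) ^ j / sqrt q * (1 + (1 - g / 4) ^ k * sqrt (vol / d u))"
proof -
  let ?r = "exit_weight q v"
  define F where "F = (tilt_op ?r ^^ j) (\<lambda>_. 1 :: real)"
  have r: "0 < ?r u" "?r u \<le> 1" for u using q by (auto simp: exit_weight_def)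
  have \<kappa>1: "\<kappa> < 1" using \<kappa>(1) \<tau>(2) by linarith
  have "(\<Sum>u\<in>V. d u * (F u)\<^sup>2) \<le> ip ?r F F" by (rule ip_ge_ip_one) (use r in auto)
  also have "\<dots> \<le> ((1 - \<kappa>) ^ j)\<^sup>2 * ip ?r (\<lambda>_. 1) (\<lambda>_. 1)"
    unfolding F_def
  proof (rule tilt_op_funpow_contraction[where P = "\<lambda>_. True"])
    show "ip ?r f (tilt_op ?r f) \<le> (1 - \<kappa>) * ip ?r f f" for f
      by (rule rayleigh_exit_weight[OF v q \<tau> g(1) gap \<delta> \<kappa>])
  qed (use \<kappa>1 r in auto)
  also have "\<dots> \<le> ((1 - \<kappa>) ^ j)\<^sup>2 * (vol / q)"
  proof (rule mult_left_mono)
    have "(1 / q - 1) * d v \<le> (1 / q - 1) * vol"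
      unfolding vol_def using q v finite_V d_pos
      by (intro mult_left_mono member_le_sum) (auto intro: less_imp_le)
    then show "ip ?r (\<lambda>_. 1) (\<lambda>_. 1) \<le> vol / q"
      unfolding ip_exit_weight[OF v q(1)] by (simp add: vol_def[symmetric] algebra_simps)
  qed simp
  finally have "sqrt (\<Sum>u\<in>V. d u * (F u)\<^sup>2) \<le> sqrt (((1 - \<kappa>) ^ j)\<^sup>2 * (vol / q))" by simp
  also have "\<dots> = (1 - \<kappa>) ^ j / sqrt q * sqrt vol"
    using \<kappa>1 by (simp add: real_sqrt_mult real_sqrt_divide)
  finally have n: "sqrt (\<Sum>u\<in>V. d u * (F u)\<^sup>2) \<le> (1 - \<kappa>) ^ j / sqrt q * sqrt vol" .
  have "P ((tilt_op ?r ^^ (k + j)) (\<lambda>_. 1)) u \<le> P ((P ^^ k) F) u"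
  proof (rule P_mono[OF u])
    fix w assume w: "w \<in> V"
    have "(tilt_op ?r ^^ k) F w \<le> (P ^^ k) F w"
      using r by (intro tilt_op_pow_le_P_pow[OF w])
        (auto simp: F_def intro!: tilt_op_pow_nonneg intro: less_imp_le)
    then show "(tilt_op ?r ^^ (k + j)) (\<lambda>_. 1) w \<le> (P ^^ k) F w"
      by (simp add: F_def funpow_add)
  qed
  also have "\<dots> = (P ^^ Suc k) F u" by simp
  also have "\<dots> \<le> sqrt (\<Sum>u\<in>V. d u * (F u)\<^sup>2) * (1 / sqrt vol + (1 - g / 4) ^ Suc k / sqrt (d u))"
    by (rule P_mixing[OF gap g(2) u])
  also have "\<dots> \<le> ((1 - \<kappa>) ^ j / sqrt q * sqrt vol) * (1 / sqrt vol + (1 - g / 4) ^ k / sqrt (d u))"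
  proof (rule mult_mono[OF n])
    have "(1 - g / 4) ^ Suc k \<le> (1 - g / 4) ^ k" using g by (intro power_decreasing) auto
    then show "1 / sqrt vol + (1 - g / 4) ^ Suc k / sqrt (d u) \<le> 1 / sqrt vol + (1 - g / 4) ^ k / sqrt (d u)"
      using d_pos[OF u] by (intro add_left_mono divide_right_mono) auto
  qed (use \<kappa>1 q g vol_pos d_pos[OF u] in auto)
  also have "\<dots> = (1 - \<kappa>) ^ j / sqrt q * (1 + (1 - g / 4) ^ k * sqrt (vol / d u))"
  proof -
    have "sqrt vol * (1 / sqrt vol + (1 - g / 4) ^ k / sqrt (d u)) = 1 + (1 - g / 4) ^ k * sqrt (vol / d u)"
      using vol_pos by (simp add: distrib_left real_sqrt_divide)
    then show ?thesis by (simp only: mult.assoc)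
  qed
  finally show ?thesis .
qed

end

subsection \<open>Exits of the lazy walk\<close>

lemma nbrs_irrefl: "v \<notin> nbrs E v"
  unfolding nbrs_def adj_rel_def by simp

lemma sym_graph_nbrs:
  assumes "graph_on n E" "n \<ge> 1" "\<And>v. v \<in> {1..n} \<Longrightarrow> deg E v > 0"
  shows "sym_graph {1..n} (nbrs E)"
proof
  show "nbrs E u \<subseteq> {1..n}" if "u \<in> {1..n}" for u
    using assms(1) unfolding graph_on_def nbrs_def adj_rel_def by auto
  show "w \<in> nbrs E u \<longleftrightarrow> u \<in> nbrs E w" for u w
    unfolding nbrs_def adj_rel_def by (auto simp: insert_commute)
  show "nbrs E u \<noteq> {}" if "u \<in> {1..n}" for u
    using assms(3)[OF that] unfolding deg_def by auto
qed (use assms(2) in auto)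

lemma expectation_bind_finite:
  fixes h :: "'b \<Rightarrow> real"
  assumes "finite (set_pmf p)" "\<And>x. x \<in> set_pmf p \<Longrightarrow> finite (set_pmf (f x))"
  shows "measure_pmf.expectation (bind_pmf p f) h
    = measure_pmf.expectation p (\<lambda>x. measure_pmf.expectation (f x) h)"
  using assms by (subst pmf_expectation_bind[where A = "set_pmf p"])
    (auto simp: integral_measure_pmf[of "set_pmf p"])

section \<open>The generating function of the number of exits\<close>

definition walk_exits :: "nat list \<Rightarrow> nat \<Rightarrow> nat" where
  "walk_exits xs v = card {t. 0 < t \<and> Suc t < length xs \<and> xs ! t = v \<and> xs ! Suc t \<noteq> v}"

text \<open>A list with \<open>nat \<lfloor>L\<rfloor> + 2\<close> entries holds exactly the counted
  times and their successors. Reading the horizon off the length permits induction by appending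
  positions.\<close>

lemma num_exits_eq_walk_exits:
  assumes "length xs = nat \<lfloor>L\<rfloor> + 2" "L \<ge> 0"
  shows "num_exits L xs v = walk_exits xs v"
proof -
  have "real t \<le> L \<longleftrightarrow> Suc t < length xs" for t
    unfolding assms(1) using assms(2) by linarith
  then show ?thesis unfolding num_exits_def walk_exits_def by simp
qed

text \<open>The condition \<open>length xs \<ge> 2\<close> reflects \<open>0 < t\<close>: appending
  to a single position adds a departure at time 0.\<close>

lemma walk_exits_snoc:
  "walk_exits (xs @ [y]) v
    = walk_exits xs v + (if length xs \<ge> 2 \<and> last xs = v \<and> y \<noteq> v then 1 else 0)"
proof (cases "xs = []")
  case True
  then show ?thesis by (simp add: walk_exits_def)
next
  case False
  let ?A = "{t. 0 < t \<and> Suc t < length xs \<and> xs ! t = v \<and> xs ! Suc t \<noteq> v}"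
  let ?B = "if length xs \<ge> 2 \<and> last xs = v \<and> y \<noteq> v then {length xs - 1} else {}"
  have last: "last xs = xs ! (length xs - 1)" using False by (rule last_conv_nth)
  have "{t. 0 < t \<and> Suc t < length (xs @ [y]) \<and> (xs @ [y]) ! t = v \<and> (xs @ [y]) ! Suc t \<noteq> v}
      = ?A \<union> ?B" (is "?C = _")
  proof (rule set_eqI)
    fix t
    consider "Suc t < length xs" | "Suc t = length xs" | "Suc t > length xs" by linarith
    then show "t \<in> ?C \<longleftrightarrow> t \<in> ?A \<union> ?B"
    proof cases
      case 2
      then have "t = length xs - 1" "t < length xs" by auto
      then show ?thesis using 2 last by (auto simp: nth_append)
    qed (auto simp: nth_append)
  qed
  moreover have "card (?A \<union> ?B) = card ?A + card ?B"
    by (rule card_Un_disjoint) (auto intro: finite_subset[of _ "{..<length xs}"])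
  ultimately show ?thesis unfolding walk_exits_def by simp
qed

context
  fixes n :: nat and E :: "nat set set"
  assumes graph: "sym_graph {1..n} (nbrs E)"
begin

interpretation sym_graph "{1..n}" "nbrs E" by (rule graph)

lemma set_lazy_step: "u \<in> {1..n} \<Longrightarrow> set_pmf (lazy_step E u) \<subseteq> {1..n}"
  unfolding lazy_step_def
  using set_pmf_of_set[OF N_nonempty finite_N, of u] N_subset[of u]
  by (auto split: if_splits)

lemma finite_set_lazy_step: "u \<in> {1..n} \<Longrightarrow> finite (set_pmf (lazy_step E u))"
  using set_lazy_step finite_subset by blast

lemma expectation_lazy_step:
  assumes u: "u \<in> {1..n}"
  shows "measure_pmf.expectation (lazy_step E u) F = P F u"
proof -
  have "measure_pmf.expectation (lazy_step E u) F
      = measure_pmf.expectation (bernoulli_pmf (1/2)) (\<lambda>stay. measure_pmf.expectation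
          (if stay then return_pmf u else pmf_of_set (nbrs E u)) F)"
    unfolding lazy_step_def using finite_N[OF u] N_nonempty[OF u]
    by (intro expectation_bind_finite) (auto intro: finite_subset[of _ UNIV])
  then show ?thesis
    using finite_N[OF u] N_nonempty[OF u]
    by (simp add: integral_pmf_of_set tilt_op_def avg_def d_def)
qed

text \<open>There are no loops, so a step from \<open>v\<close> is an exit exactly when it is not
  lazy; the factor \<open>q\<close> falls on the averaging half only.\<close>

lemma expectation_lazy_step_exit:
  assumes u: "u \<in> {1..n}"
  shows "measure_pmf.expectation (lazy_step E u) (\<lambda>y. (if u = v \<and> y \<noteq> v then q else 1) * F y)
    = tilt_op (exit_weight q v) F u"
proof -
  have "(\<Sum>w\<in>nbrs E v. (if w \<noteq> v then q else 1) * F w) = q * (\<Sum>w\<in>nbrs E v. F w)"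
    unfolding sum_distrib_left by (rule sum.cong) (auto simp: nbrs_irrefl)
  then show ?thesis
    unfolding expectation_lazy_step[OF u] tilt_op_def avg_def exit_weight_def by simp
qed

lemma lazy_walk_support:
  assumes "v0 \<in> {1..n}" "xs \<in> set_pmf (lazy_walk E v0 T)"
  shows "length xs = Suc T \<and> set xs \<subseteq> {1..n}"
  using assms(2)
proof (induction T arbitrary: xs)
  case 0
  then show ?case using assms(1) by simp
next
  case (Suc T)
  then obtain ys y where ys: "ys \<in> set_pmf (lazy_walk E v0 T)" "y \<in> set_pmf (lazy_step E (last ys))"
    "xs = ys @ [y]" by auto
  with Suc.IH have "length ys = Suc T" "set ys \<subseteq> {1..n}" by auto
  moreover from this have "last ys \<in> {1..n}" by (metis last_in_set length_0_conv nat.distinct(1) subsetD)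
  ultimately show ?case using ys set_lazy_step[of "last ys"] by auto
qed

lemma last_lazy_walk:
  assumes "v0 \<in> {1..n}" "xs \<in> set_pmf (lazy_walk E v0 T)"
  shows "last xs \<in> {1..n}"
  using lazy_walk_support[OF assms] by (metis last_in_set length_0_conv nat.distinct(1) subsetD)

lemma finite_lazy_walk:
  assumes "v0 \<in> {1..n}"
  shows "finite (set_pmf (lazy_walk E v0 T))"
proof (rule finite_subset)
  show "set_pmf (lazy_walk E v0 T) \<subseteq> {xs. set xs \<subseteq> {1..n} \<and> length xs = Suc T}"
    using lazy_walk_support[OF assms] by auto
qed (rule finite_lists_length_eq, simp)

lemma expectation_lazy_walk_Suc:
  fixes h :: "nat list \<Rightarrow> real"
  assumes v0: "v0 \<in> {1..n}"
  shows "measure_pmf.expectation (lazy_walk E v0 (Suc T)) h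
    = measure_pmf.expectation (lazy_walk E v0 T)
        (\<lambda>xs. measure_pmf.expectation (lazy_step E (last xs)) (\<lambda>y. h (xs @ [y])))"
proof -
  have "measure_pmf.expectation (lazy_walk E v0 (Suc T)) h
      = measure_pmf.expectation (lazy_walk E v0 T)
          (\<lambda>xs. measure_pmf.expectation (map_pmf (\<lambda>y. xs @ [y]) (lazy_step E (last xs))) h)"
    unfolding lazy_walk.simps
  proof (rule expectation_bind_finite)
    fix xs assume "xs \<in> set_pmf (lazy_walk E v0 T)"
    then show "finite (set_pmf (map_pmf (\<lambda>y. xs @ [y]) (lazy_step E (last xs))))"
      using finite_set_lazy_step[OF last_lazy_walk[OF v0]] by simp
  qed (rule finite_lazy_walk[OF v0])
  then show ?thesis by simp
qed

text \<open>Condition on all but the last step, which turns \<open>F\<close> into its tilted image;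
  hence the induction is over arbitrary \<open>F\<close>. The first step carries no weight and
  remains as the outer \<open>P\<close>.\<close>

lemma expectation_walk_exits:
  assumes v0: "v0 \<in> {1..n}"
  shows "measure_pmf.expectation (lazy_walk E v0 (Suc T)) (\<lambda>xs. q ^ walk_exits xs v * F (last xs))
    = P ((tilt_op (exit_weight q v) ^^ T) F) v0"
proof (induction T arbitrary: F)
  case 0
  have "walk_exits [v0, y] v = 0" for y
    using walk_exits_snoc[of "[v0]" y v] by (simp add: walk_exits_def)
  then have "measure_pmf.expectation (lazy_walk E v0 (Suc 0)) (\<lambda>xs. q ^ walk_exits xs v * F (last xs))
      = measure_pmf.expectation (lazy_step E v0) F"
    unfolding expectation_lazy_walk_Suc[OF v0] by simp
  then show ?case using expectation_lazy_step[OF v0] by simp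
next
  case (Suc T)
  have "measure_pmf.expectation (lazy_walk E v0 (Suc (Suc T))) (\<lambda>xs. q ^ walk_exits xs v * F (last xs))
      = measure_pmf.expectation (lazy_walk E v0 (Suc T))
          (\<lambda>xs. q ^ walk_exits xs v * tilt_op (exit_weight q v) F (last xs))"
    unfolding expectation_lazy_walk_Suc[OF v0, of "Suc T"]
  proof (rule integral_cong_AE)
    show "AE xs in measure_pmf (lazy_walk E v0 (Suc T)).
        measure_pmf.expectation (lazy_step E (last xs)) (\<lambda>y. q ^ walk_exits (xs @ [y]) v * F (last (xs @ [y])))
        = q ^ walk_exits xs v * tilt_op (exit_weight q v) F (last xs)"
    proof (rule AE_pmfI)
      fix xs assume xs: "xs \<in> set_pmf (lazy_walk E v0 (Suc T))"
      have len: "length xs \<ge> 2" using lazy_walk_support[OF v0 xs] by simp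
      have "(\<lambda>y. q ^ walk_exits (xs @ [y]) v * F (last (xs @ [y])))
          = (\<lambda>y. q ^ walk_exits xs v * ((if last xs = v \<and> y \<noteq> v then q else 1) * F y))"
        using len by (auto simp: fun_eq_iff walk_exits_snoc)
      then show "measure_pmf.expectation (lazy_step E (last xs))
          (\<lambda>y. q ^ walk_exits (xs @ [y]) v * F (last (xs @ [y])))
        = q ^ walk_exits xs v * tilt_op (exit_weight q v) F (last xs)"
        using expectation_lazy_step_exit[OF last_lazy_walk[OF v0 xs], of v q F] by simp
    qed
  qed auto
  also have "\<dots> = P ((tilt_op (exit_weight q v) ^^ Suc T) F) v0"
    unfolding Suc.IH by (simp add: funpow_swap1)
  finally show ?case .
qed

text \<open>Exponential Markov inequality: since \<open>q < 1\<close>, fewer than \<open>a\<close>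
  exits force \<open>q powr (- a) * q ^ walk_exits xs v\<close> to be at least 1.\<close>

lemma prob_few_exits:
  assumes v0: "v0 \<in> {1..n}" and q: "0 < q" "q < 1" and L: "L \<ge> 0"
  shows "measure_pmf.prob (lazy_walk E v0 (nat \<lfloor>L\<rfloor> + 1)) {xs. real (num_exits L xs v) < a}
    \<le> q powr (- a) * P ((tilt_op (exit_weight q v) ^^ nat \<lfloor>L\<rfloor>) (\<lambda>_. 1)) v0"
proof -
  define p where "p = lazy_walk E v0 (Suc (nat \<lfloor>L\<rfloor>))"
  have fin: "finite (set_pmf p)" unfolding p_def by (rule finite_lazy_walk[OF v0])
  let ?A = "{xs. real (num_exits L xs v) < a}"
  have "measure_pmf.prob p ?A = measure_pmf.expectation p (indicat_real ?A)" by simp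
  also have "\<dots> \<le> measure_pmf.expectation p (\<lambda>xs. q powr (- a) * q ^ walk_exits xs v)"
  proof (rule integral_mono_AE)
    show "AE xs in measure_pmf p. indicat_real ?A xs \<le> q powr (- a) * q ^ walk_exits xs v"
    proof (rule AE_pmfI)
      fix xs assume "xs \<in> set_pmf p"
      then have "num_exits L xs v = walk_exits xs v"
        using lazy_walk_support[OF v0] L unfolding p_def by (intro num_exits_eq_walk_exits) auto
      moreover have "q powr (- a) * q ^ k \<ge> 1" if "real k < a" for k
      proof -
        have "q powr (- a) * q ^ k = q powr (real k - a)"
          using q by (simp add: powr_realpow[symmetric] powr_add[symmetric])
        also have "\<dots> \<ge> q powr 0" using that q by (intro powr_mono') auto
        finally show ?thesis using q by simp
      qed
      moreover have "q powr (- a) * q ^ k \<ge> 0" for k using q by simp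
      ultimately show "indicat_real ?A xs \<le> q powr (- a) * q ^ walk_exits xs v"
        by (auto simp: indicator_def)
    qed
  qed (auto intro: integrable_measure_pmf_finite fin)
  also have "\<dots> = q powr (- a) * P ((tilt_op (exit_weight q v) ^^ nat \<lfloor>L\<rfloor>) (\<lambda>_. 1)) v0"
    using expectation_walk_exits[OF v0, of "nat \<lfloor>L\<rfloor>" q v "\<lambda>_. 1"] unfolding p_def by simp
  finally show ?thesis unfolding p_def by simp
qed

lemma prob_all_many_exits:
  assumes v0: "v0 \<in> {1..n}" and q: "0 < q" "q < 1" and L: "L \<ge> 0"
    and B: "\<And>v. v \<in> {1..n} \<Longrightarrow> P ((tilt_op (exit_weight q v) ^^ nat \<lfloor>L\<rfloor>) (\<lambda>_. 1)) v0 \<le> B"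
  shows "1 - real n * (q powr (- a) * B)
    \<le> measure_pmf.prob (lazy_walk E v0 (nat \<lfloor>L\<rfloor> + 1)) {xs. \<forall>v\<in>{1..n}. real (num_exits L xs v) \<ge> a}"
proof -
  let ?p = "measure_pmf.prob (lazy_walk E v0 (nat \<lfloor>L\<rfloor> + 1))"
  let ?A = "\<lambda>v. {xs. real (num_exits L xs v) < a}"
  have "{xs. \<forall>v\<in>{1..n}. real (num_exits L xs v) \<ge> a} = UNIV - (\<Union>v\<in>{1..n}. ?A v)"
    by (auto simp: not_less)
  then have "?p {xs. \<forall>v\<in>{1..n}. real (num_exits L xs v) \<ge> a} = 1 - ?p (\<Union>v\<in>{1..n}. ?A v)"
    using measure_pmf.prob_compl[of "\<Union>v\<in>{1..n}. ?A v"] by simp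
  moreover have "?p (\<Union>v\<in>{1..n}. ?A v) \<le> (\<Sum>v\<in>{1..n}. ?p (?A v))"
    by (rule measure_pmf.finite_measure_subadditive_finite) auto
  moreover have "(\<Sum>v\<in>{1..n}. ?p (?A v)) \<le> (\<Sum>v\<in>{1..n}. q powr (- a) * B)"
  proof (rule sum_mono)
    fix v assume "v \<in> {1..n}"
    from mult_left_mono[OF B[OF this], of "q powr (- a)"] prob_few_exits[OF v0 q L, of v a]
    show "?p (?A v) \<le> q powr (- a) * B" by simp
  qed
  ultimately show ?thesis by simp
qed

end

subsection \<open>Pseudo-random graphs\<close>

lemma card_edge_boundary_le:
  assumes graph: "sym_graph {1..n} (nbrs E)" and S: "S \<subseteq> {1..n}"
  shows "real (card (edge_boundary n E S))
    \<le> sym_graph.dart_sum {1..n} (nbrs E) (\<lambda>u w. of_bool (u \<in> S \<and> w \<notin> S))"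
proof -
  interpret sym_graph "{1..n}" "nbrs E" by (rule graph)
  let ?D = "{p \<in> Sigma {1..n} (nbrs E). fst p \<in> S \<and> snd p \<notin> S}"
  have fin: "finite (Sigma {1..n} (nbrs E))" using finite_N by auto
  have "edge_boundary n E S \<subseteq> (\<lambda>p. {fst p, snd p}) ` ?D"
  proof
    fix e assume "e \<in> edge_boundary n E S"
    then obtain a b where ab: "e \<in> E" "a \<in> S" "b \<in> {1..n} - S" "e = {a, b}"
      unfolding edge_boundary_def edges_between_def by auto
    then have "b \<in> nbrs E a" unfolding nbrs_def adj_rel_def by auto
    then have "(a, b) \<in> ?D" using ab S by auto
    then show "e \<in> (\<lambda>p. {fst p, snd p}) ` ?D"
      using ab(4) by (intro image_eqI[of _ _ "(a, b)"]) simp_all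
  qed
  then have "card (edge_boundary n E S) \<le> card ((\<lambda>p. {fst p, snd p}) ` ?D)"
    using fin by (intro card_mono) auto
  also have "\<dots> \<le> card ?D" using fin by (intro card_image_le) auto
  finally have "real (card (edge_boundary n E S)) \<le> real (card ?D)" by simp
  also have "\<dots> = (\<Sum>p\<in>?D. 1)" by simp
  also have "\<dots> = (\<Sum>p\<in>Sigma {1..n} (nbrs E). if fst p \<in> S \<and> snd p \<notin> S then 1 else 0)"
    by (rule sum.inter_filter[OF fin])
  finally show ?thesis unfolding dart_sum_def of_bool_def .
qed

text \<open>For \<open>S\<close> of size at most \<open>n / 2\<close> the complement has at least
  \<open>n / 2\<close> elements, so the quadratic bound of \<open>P3\<close> becomes linear in
  \<open>card S\<close>.\<close>

lemma P3_expanding: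
  assumes graph: "sym_graph {1..n} (nbrs E)" and P3: "P3 \<alpha> n E" and \<alpha>: "\<alpha> > 0" and n: "n \<ge> 1"
  shows "sym_graph.expanding {1..n} (nbrs E) (n / 2) (\<alpha> * ln n / 4)"
proof -
  interpret sym_graph "{1..n}" "nbrs E" by (rule graph)
  show ?thesis
    unfolding expanding_def
  proof (intro allI impI, elim conjE)
    fix S assume S: "S \<noteq> {}" "S \<subseteq> {1..n}" "real (card S) \<le> real n / 2"
    have "real (card ({1..n} - S)) = real n - real (card S)"
      using S(2) card_mono[OF _ S(2)] by (subst card_Diff_subset) (auto intro: finite_subset simp: of_nat_diff)
    then have co: "real n / 2 \<le> real (card ({1..n} - S))" using S(3) by simp
    have "\<alpha> * ln n / 4 * card S = card S * (real n / 2) * (\<alpha> * ln n / (2 * n))"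
      using n by (simp add: field_simps)
    also have "\<dots> \<le> card S * real (card ({1..n} - S)) * (\<alpha> * ln n / (2 * n))"
      using co \<alpha> n by (intro mult_right_mono mult_left_mono) auto
    also have "\<dots> < real (card (edge_boundary n E S))"
      using P3[unfolded P3_def, rule_format, of S] S by (simp add: mult.assoc)
    also have "\<dots> \<le> dart_sum (\<lambda>u w. of_bool (u \<in> S \<and> w \<notin> S))"
      by (rule card_edge_boundary_le[OF graph S(2)])
    finally show "\<alpha> * ln n / 4 * card S \<le> dart_sum (\<lambda>u w. of_bool (u \<in> S \<and> w \<notin> S))" by simp
  qed
qed

text \<open>Collects the losses in the exponent. Four factors \<open>1 - \<epsilon> / 100\<close>
  come from the decay rate and one from setting aside the mixing steps; the quotient compares
  \<open>d v\<close> with the average degree; \<open>1 + \<epsilon> / 2\<close> is half of the time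
  constant \<open>2 + \<epsilon>\<close>.\<close>

lemma exponent_bound:
  fixes \<epsilon> :: real
  assumes "0 < \<epsilon>" "\<epsilon> < 1"
  shows "1 + \<epsilon> / 5 \<le> (1 - \<epsilon> / 100) ^ 5 * ((1 - 13 / 250 * \<epsilon>) / (1 + 13 / 250 * \<epsilon>)) * (1 + \<epsilon> / 2)"
proof -
  have 1: "1 - \<epsilon> / 20 \<le> (1 - \<epsilon> / 100) ^ 5"
    using Bernoulli_inequality[of "- \<epsilon> / 100" 5] assms by simp
  have 2: "1 - 13 / 125 * \<epsilon> \<le> (1 - 13 / 250 * \<epsilon>) / (1 + 13 / 250 * \<epsilon>)"
    using assms by (simp add: field_simps)
  have "1 + \<epsilon> / 5 \<le> (1 - \<epsilon> / 20) * (1 - 13 / 125 * \<epsilon>) * (1 + \<epsilon> / 2)"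
  proof -
    have "\<epsilon> * \<epsilon> \<le> \<epsilon>" using assms by (simp add: mult_le_cancel_left1)
    moreover have "\<epsilon> * \<epsilon> * \<epsilon> \<ge> 0" using assms by simp
    moreover have "(1 - \<epsilon> / 20) * (1 - 13 / 125 * \<epsilon>) * (1 + \<epsilon> / 2) - (1 + \<epsilon> / 5)
        = 73 / 500 * \<epsilon> - 359 / 5000 * (\<epsilon> * \<epsilon>) + 13 / 5000 * (\<epsilon> * \<epsilon> * \<epsilon>)"
      by (simp add: field_simps)
    ultimately show ?thesis using assms(1) by linarith
  qed
  also have "\<dots> \<le> (1 - \<epsilon> / 100) ^ 5 * ((1 - 13 / 250 * \<epsilon>) / (1 + 13 / 250 * \<epsilon>)) * (1 + \<epsilon> / 2)"
    using 1 2 assms by (intro mult_right_mono mult_mono) auto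
  finally show ?thesis .
qed

text \<open>The quantitative statement for one \<open>n\<close>. The size conditions on
  \<open>n\<close> involve only \<open>\<epsilon>\<close>, so they hold eventually whatever the
  graphs and starting vertices are.\<close>

lemma prob_many_exits_bound:
  fixes \<epsilon> \<alpha> :: real
  defines "q \<equiv> \<epsilon> / 100" and "b \<equiv> 13 / 250 * \<epsilon>"
  defines "c \<equiv> (1 - q) ^ 4 * ((1 - b) / (1 + b))"
  assumes \<epsilon>: "0 < \<epsilon>" "\<epsilon> < 1" and \<alpha>: "\<alpha> \<ge> 1500 / \<epsilon>\<^sup>2"
    and graph_on: "graph_on n E" and P2: "P2 \<alpha> n E" and P3: "P3 \<alpha> n E" and v0: "v0 \<in> {1..n}"
    and n: "n \<ge> 2" "4 * (1 / q - 1) \<le> q * (9 / 256) * (5 / 6 * (1500 / \<epsilon>\<^sup>2 * ln n))"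
      "c / (2 * n) \<le> q / 2" "c / (2 * n) \<le> (1 - q) * q * (9 / 256) / 8"
      "1024 / 9 * ln n + 3 \<le> (2 + \<epsilon>) * q * n * ln n"
  shows "1 - 2 / sqrt q * n powr (- \<epsilon> / 10)
    \<le> measure_pmf.prob (lazy_walk E v0 (nat \<lfloor>L2 \<epsilon> n\<rfloor> + 1))
        {xs. \<forall>v\<in>{1..n}. real (num_exits (L2 \<epsilon> n) xs v) \<ge> \<epsilon> / 10 / ln (1 / q) * ln n}"
proof -
  define l where "l = ln (real n)"
  define D where "D = \<alpha> * l"
  define g :: real where "g = 9 / 256"
  define \<kappa> where "\<kappa> = c / (2 * n)"
  define k where "k = nat \<lceil>4 / g * l\<rceil>"
  define T where "T = nat \<lfloor>L2 \<epsilon> n\<rfloor>"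
  define j where "j = T - k"
  have q: "0 < q" "q < 1" unfolding q_def using \<epsilon> by auto
  have b: "0 < b" "b < 1" unfolding b_def using \<epsilon> by auto
  have l: "l > 0" unfolding l_def using n(1) by simp
  have "1500 / \<epsilon>\<^sup>2 > 0" using \<epsilon> by simp
  then have \<alpha>0: "\<alpha> > 0" using \<alpha> by linarith
  have D: "D > 0" unfolding D_def using \<alpha>0 l by simp
  \<comment> \<open>The constant \<open>13 / 250\<close> lies just above
    \<open>2 / sqrt 1500\<close>, so the deviation allowed by \<open>P2\<close> is at most a
    fraction \<open>b\<close> of \<open>D\<close>.\<close>
  have dev: "2 * sqrt \<alpha> * l \<le> b * D"
  proof -
    have "4 \<le> b\<^sup>2 * (1500 / \<epsilon>\<^sup>2)" unfolding b_def using \<epsilon> by (simp add: power2_eq_square field_simps)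
    also have "\<dots> \<le> b\<^sup>2 * \<alpha>" using \<alpha> by (rule mult_left_mono) simp
    finally have "2 \<le> sqrt (b\<^sup>2 * \<alpha>)" by (intro real_le_rsqrt) simp
    then have "2 \<le> b * sqrt \<alpha>" using b by (simp add: real_sqrt_mult)
    then have "2 * (sqrt \<alpha> * l) \<le> b * sqrt \<alpha> * (sqrt \<alpha> * l)"
      using \<alpha>0 l by (intro mult_right_mono) auto
    also have "\<dots> = b * ((sqrt \<alpha> * sqrt \<alpha>) * l)" by (simp only: mult_ac)
    finally show ?thesis unfolding D_def using \<alpha>0 by (simp add: mult.assoc)
  qed
  have deg: "5 / 6 * D \<le> real (deg E u)" "real (deg E u) \<le> 4 / 3 * D"
    "(1 - b) * D \<le> real (deg E u)" "real (deg E u) \<le> (1 + b) * D" if "u \<in> {1..n}" for u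
    using P2[unfolded P2_def, rule_format, OF that] dev
    unfolding D_def[symmetric] l_def[symmetric] by (auto simp: algebra_simps D_def l_def)
  have graph: "sym_graph {1..n} (nbrs E)"
  proof (rule sym_graph_nbrs[OF graph_on])
    show "deg E u > 0" if "u \<in> {1..n}" for u
      using deg(1)[OF that] D by (metis mult_pos_pos of_nat_0_less_iff order_less_le_trans zero_less_divide_iff zero_less_numeral)
  qed (use n(1) in simp)
  interpret sym_graph "{1..n}" "nbrs E" by (rule graph)
  have d_eq: "d u = real (deg E u)" for u unfolding d_def deg_def ..
  \<comment> \<open>Expansion \<open>D / 4\<close> against maximal degree \<open>4 / 3 * D\<close>
    gives the squared ratio \<open>9 / 256\<close>, independent of \<open>n\<close>.\<close>
  have gap: "g * (\<Sum>u\<in>{1..n}. d u * (h u)\<^sup>2) \<le> form h" if "(\<Sum>u\<in>{1..n}. d u * h u) = 0" for h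
  proof -
    have "(D / 4)\<^sup>2 * (\<Sum>u\<in>{1..n}. d u * (h u)\<^sup>2) \<le> (4 / 3 * D)\<^sup>2 * form h"
      using P3_expanding[OF graph P3 \<alpha>0] n(1) D deg(2) that
      by (intro cheeger) (auto simp: D_def l_def d_eq)
    then have "D\<^sup>2 * (g * (\<Sum>u\<in>{1..n}. d u * (h u)\<^sup>2)) \<le> D\<^sup>2 * form h"
      unfolding g_def by (simp add: power2_eq_square field_simps)
    then show ?thesis using D by (simp add: mult_le_cancel_left)
  qed
  have vol_le: "vol \<le> n * ((1 + b) * D)" "vol \<le> n * (4 / 3 * D)"
    using sum_mono[of "{1..n}" d "\<lambda>_. (1 + b) * D"] sum_mono[of "{1..n}" d "\<lambda>_. 4 / 3 * D"] deg
    unfolding vol_def d_eq by auto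
  have \<delta>: "4 * (1 / q - 1) \<le> q * g * (5 / 6 * D)"
  proof -
    have "1500 / \<epsilon>\<^sup>2 * l \<le> D" unfolding D_def using \<alpha> l by (intro mult_right_mono) auto
    then have "q * g * (5 / 6 * (1500 / \<epsilon>\<^sup>2 * l)) \<le> q * g * (5 / 6 * D)"
      using q unfolding g_def by (intro mult_left_mono) auto
    then show ?thesis using n(2) unfolding g_def l_def by linarith
  qed
  have c: "0 < c" unfolding c_def using q b by simp
  have \<kappa>: "\<kappa> \<le> q / 2" "\<kappa> \<le> (1 - q) * q * g / 8"
    using n(3,4) unfolding \<kappa>_def g_def by auto
  \<comment> \<open>The value \<open>c / (2 * n)\<close> is chosen so that the upper bound
    \<open>n * ((1 + b) * D)\<close> on \<open>vol\<close> and the lower bound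
    \<open>(1 - b) * D\<close> on \<open>d v\<close> just match.\<close>
  have \<kappa>d: "2 * \<kappa> * vol \<le> (1 - q) ^ 3 * (1 - q) * d v" if "v \<in> {1..n}" for v
  proof -
    have "2 * \<kappa> * vol \<le> 2 * \<kappa> * (n * ((1 + b) * D))"
      using vol_le(1) c unfolding \<kappa>_def by (intro mult_left_mono) auto
    also have "\<dots> = (1 - q) ^ 4 * ((1 - b) * D)"
      unfolding \<kappa>_def c_def using n(1) b by simp
    also have "\<dots> \<le> (1 - q) ^ 4 * d v"
      using deg(3)[OF that] q unfolding d_eq by (intro mult_left_mono) auto
    finally show ?thesis by (simp add: power_def numeral_eq_Suc mult_ac)
  qed
  have L0: "L2 \<epsilon> n \<ge> 0" unfolding L2_def using \<epsilon> l unfolding l_def by simp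
  have kle: "real k \<le> 1024 / 9 * l + 1"
  proof -
    have "4 / g * l = 1024 / 9 * l" unfolding g_def by simp
    then show ?thesis unfolding k_def using l by linarith
  qed
  have Tge: "L2 \<epsilon> n - 1 \<le> real T" unfolding T_def using L0 by linarith
  \<comment> \<open>The mixing steps and both roundings together use at most a fraction
    \<open>q\<close> of the running time.\<close>
  have jge: "(2 + \<epsilon>) * (1 - q) * n * l \<le> real T - real k"
    using kle Tge n(5) unfolding L2_def l_def by (simp add: algebra_simps)
  have "0 \<le> (2 + \<epsilon>) * (1 - q) * n * l" using \<epsilon> q l by simp
  then have kT: "k \<le> T" using jge by linarith
  then have Tkj: "T = k + j" and jr: "real j = real T - real k" unfolding j_def by auto
  have decay: "(1 - \<kappa>) ^ j \<le> n powr (- (1 + \<epsilon> / 5))"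
  proof -
    have "\<kappa> \<le> 1" using \<kappa>(1) q by linarith
    then have "(1 - \<kappa>) ^ j \<le> exp (- \<kappa>) ^ j"
      using exp_ge_add_one_self[of "- \<kappa>"] by (intro power_mono) auto
    also have "\<dots> = exp (- (\<kappa> * j))" by (simp add: exp_of_nat_mult[symmetric] mult.commute)
    also have "\<dots> \<le> exp (- ((1 + \<epsilon> / 5) * l))"
    proof -
      have "(1 + \<epsilon> / 5) * l \<le> ((1 - q) ^ 5 * ((1 - b) / (1 + b)) * (1 + \<epsilon> / 2)) * l"
        using exponent_bound[OF \<epsilon>] l unfolding q_def b_def by (intro mult_right_mono) auto
      also have "\<dots> = \<kappa> * ((2 + \<epsilon>) * (1 - q) * n * l)"
      proof -
        have "(1 - q) ^ 5 = (1 - q) ^ 4 * (1 - q)" by (simp add: power_def numeral_eq_Suc mult_ac)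
        moreover have "\<kappa> * ((2 + \<epsilon>) * (1 - q) * n * l) = c * (1 - q) * (1 + \<epsilon> / 2) * l"
          unfolding \<kappa>_def using n(1) by (simp add: field_simps)
        ultimately show ?thesis unfolding c_def by (simp only: mult_ac)
      qed
      also have "\<dots> \<le> \<kappa> * j"
        using jge jr c unfolding \<kappa>_def by (intro mult_left_mono) auto
      finally show ?thesis by simp
    qed
    also have "\<dots> = n powr (- (1 + \<epsilon> / 5))"
      unfolding powr_def l_def using n(1) by (simp add: algebra_simps)
    finally show ?thesis .
  qed
  \<comment> \<open>The choice of \<open>k\<close> brings the contraction factor down to
    \<open>1 / n\<close>, which outweighs the square root of order \<open>sqrt n\<close>.\<close>
  have mixed: "(1 - g / 4) ^ k * sqrt (vol / d v0) \<le> 1"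
  proof -
    have "(1 - g / 4) ^ k \<le> exp (- g / 4) ^ k"
      using exp_ge_add_one_self[of "- g / 4"] unfolding g_def by (intro power_mono) auto
    also have "\<dots> = exp (- (g / 4 * k))" by (simp add: exp_of_nat_mult[symmetric] mult.commute)
    also have "\<dots> \<le> exp (- l)"
    proof -
      have "4 / g * l \<le> k" unfolding k_def by linarith
      then show ?thesis unfolding g_def by simp
    qed
    also have "\<dots> = 1 / n" unfolding l_def using n(1) by (simp add: exp_minus field_simps)
    finally have 1: "(1 - g / 4) ^ k \<le> 1 / n" .
    have "vol / d v0 \<le> n * (4 / 3 * D) / (5 / 6 * D)"
      using vol_le(2) deg(1)[OF v0] D vol_pos unfolding d_eq by (intro frac_le) auto
    also have "\<dots> = 8 / 5 * n" using D by simp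
    also have "\<dots> \<le> (real n)\<^sup>2" using n(1) by (simp add: power2_eq_square)
    finally have "sqrt (vol / d v0) \<le> sqrt ((real n)\<^sup>2)" by (rule real_sqrt_le_mono)
    then have 2: "sqrt (vol / d v0) \<le> n" by simp
    have "(1 - g / 4) ^ k * sqrt (vol / d v0) \<le> 1 / n * n"
      using 1 2 vol_pos d_pos[OF v0] by (intro mult_mono) auto
    then show ?thesis using n(1) by simp
  qed
  have B: "P ((tilt_op (exit_weight q v) ^^ T) (\<lambda>_. 1)) v0
      \<le> 2 / sqrt q * n powr (- (1 + \<epsilon> / 5))" if v: "v \<in> {1..n}" for v
  proof -
    \<comment> \<open>The error parameter \<open>\<tau>\<close> is taken equal to
      \<open>q\<close>.\<close>
    have "P ((tilt_op (exit_weight q v) ^^ T) (\<lambda>_. 1)) v0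
        \<le> (1 - \<kappa>) ^ j / sqrt q * (1 + (1 - g / 4) ^ k * sqrt (vol / d v0))"
      unfolding Tkj
      by (rule exit_weight_decay[OF v q q _ _ gap _ _ \<delta> \<kappa> \<kappa>d[OF v] v0])
        (use D deg(1) in \<open>auto simp: g_def d_eq\<close>)
    also have "\<dots> \<le> n powr (- (1 + \<epsilon> / 5)) / sqrt q * 2"
      using decay mixed q vol_pos d_pos[OF v0]
      by (intro mult_mono divide_right_mono) (auto simp: g_def)
    finally show ?thesis by (simp add: mult_ac)
  qed
  \<comment> \<open>With this threshold Markov's inequality costs only
    \<open>n powr (\<epsilon> / 10)\<close>, half of the surplus \<open>\<epsilon> / 5\<close>
    remaining after the union bound.\<close>
  define a where "a = \<epsilon> / 10 / ln (1 / q) * ln n"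
  have "ln (1 / q) > 0" using q by simp
  then have qa: "q powr (- a) = n powr (\<epsilon> / 10)"
    unfolding powr_def a_def using q n(1) by (simp add: ln_div)
  have "n powr 1 * n powr (\<epsilon> / 10) * n powr (- (1 + \<epsilon> / 5)) = n powr (- \<epsilon> / 10)"
    unfolding powr_add[symmetric] by simp
  moreover have "real n * (q powr (- a) * (2 / sqrt q * n powr (- (1 + \<epsilon> / 5))))
      = 2 / sqrt q * (n powr 1 * n powr (\<epsilon> / 10) * n powr (- (1 + \<epsilon> / 5)))"
    unfolding qa using n(1) by simp
  ultimately have err: "real n * (q powr (- a) * (2 / sqrt q * n powr (- (1 + \<epsilon> / 5))))
      = 2 / sqrt q * n powr (- \<epsilon> / 10)" by (simp only:)
  show ?thesis
    using prob_all_many_exits[OF graph v0 q L0 B[unfolded T_def], of a] unfolding err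
    unfolding a_def .
qed

theorem theorem3p3:
  "\<exists>\<epsilon>0>0. \<forall>\<epsilon>::real. 0 < \<epsilon> \<and> \<epsilon> < \<epsilon>0 \<longrightarrow>
     (\<forall>(\<alpha> :: nat \<Rightarrow> real) (G :: nat \<Rightarrow> nat set set) (v0 :: nat \<Rightarrow> nat).
        (\<forall>\<^sub>F n in sequentially. \<alpha> n \<ge> 1500 / \<epsilon>\<^sup>2) \<and>
        pseudo_random \<alpha> G \<and>
        (\<forall>\<^sub>F n in sequentially. v0 n \<in> {1..n}) \<longrightarrow>
        (\<exists>\<rho>>0.
           (\<lambda>n. measure_pmf.prob (lazy_walk (G n) (v0 n) (nat \<lfloor>L2 \<epsilon> n\<rfloor> + 1))
                  {xs. \<forall>v\<in>{1..n}. real (num_exits (L2 \<epsilon> n) xs v) \<ge> \<rho> * ln (real n)})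
           \<longlonglongrightarrow> 1))"
\<comment> \<open>The witness 1 suffices: the numerical estimates hold for every
  \<open>\<epsilon>\<close> between 0 and 1.\<close>
proof (rule exI[of _ 1], intro conjI allI impI)
  fix \<epsilon> :: real and \<alpha> :: "nat \<Rightarrow> real" and G :: "nat \<Rightarrow> nat set set" and v0 :: "nat \<Rightarrow> nat"
  assume e: "0 < \<epsilon> \<and> \<epsilon> < 1"
    and asm: "(\<forall>\<^sub>F n in sequentially. \<alpha> n \<ge> 1500 / \<epsilon>\<^sup>2) \<and> pseudo_random \<alpha> G \<and>
        (\<forall>\<^sub>F n in sequentially. v0 n \<in> {1..n})"
  define q where "q = \<epsilon> / 100"
  define c where "c = (1 - q) ^ 4 * ((1 - 13 / 250 * \<epsilon>) / (1 + 13 / 250 * \<epsilon>))"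
  define \<rho> where "\<rho> = \<epsilon> / 10 / ln (1 / q)"
  have q: "0 < q" "q < 1" using e unfolding q_def by auto
  have \<rho>: "\<rho> > 0" unfolding \<rho>_def using e q by simp
  have ev: "\<forall>\<^sub>F n in sequentially. \<alpha> n \<ge> 1500 / \<epsilon>\<^sup>2"
    "\<forall>\<^sub>F n in sequentially. graph_on n (G n) \<and> P2 (\<alpha> n) n (G n) \<and> P3 (\<alpha> n) n (G n)"
    "\<forall>\<^sub>F n in sequentially. v0 n \<in> {1..n}"
    using asm unfolding pseudo_random_def by (auto elim: eventually_mono)
  have n1: "\<forall>\<^sub>F n in sequentially. 4 * (1 / q - 1) \<le> q * (9 / 256) * (5 / 6 * (1500 / \<epsilon>\<^sup>2 * ln (real n)))"
    using q e by real_asymp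
  have n2: "\<forall>\<^sub>F n in sequentially. c / (2 * real n) \<le> q / 2" using q by real_asymp
  have "0 < (1 - q) * q * (9 / 256) / 8" using q by simp
  then have n3: "\<forall>\<^sub>F n in sequentially. c / (2 * real n) \<le> (1 - q) * q * (9 / 256) / 8" by real_asymp
  have n4: "\<forall>\<^sub>F n in sequentially. 1024 / 9 * ln (real n) + 3 \<le> (2 + \<epsilon>) * q * real n * ln (real n)"
    using q e by real_asymp
  have lower: "\<forall>\<^sub>F n in sequentially. 1 - 2 / sqrt q * real n powr (- \<epsilon> / 10)
    \<le> measure_pmf.prob (lazy_walk (G n) (v0 n) (nat \<lfloor>L2 \<epsilon> n\<rfloor> + 1))
        {xs. \<forall>v\<in>{1..n}. real (num_exits (L2 \<epsilon> n) xs v) \<ge> \<rho> * ln (real n)}"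
    using ev n1 n2 n3 n4 eventually_ge_at_top[of 2]
  proof eventually_elim
    case (elim n)
    then show ?case unfolding \<rho>_def q_def c_def
      using e by (intro prob_many_exits_bound[of \<epsilon> "\<alpha> n"]) auto
  qed
  have lim: "(\<lambda>n. 1 - 2 / sqrt q * real n powr (- \<epsilon> / 10)) \<longlonglongrightarrow> 1"
    using e by real_asymp
  show "\<exists>\<rho>>0. (\<lambda>n. measure_pmf.prob (lazy_walk (G n) (v0 n) (nat \<lfloor>L2 \<epsilon> n\<rfloor> + 1))
                  {xs. \<forall>v\<in>{1..n}. real (num_exits (L2 \<epsilon> n) xs v) \<ge> \<rho> * ln (real n)}) \<longlonglongrightarrow> 1"
  proof (intro exI[of _ \<rho>] conjI \<rho>)
    show "(\<lambda>n. measure_pmf.prob (lazy_walk (G n) (v0 n) (nat \<lfloor>L2 \<epsilon> n\<rfloor> + 1))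
        {xs. \<forall>v\<in>{1..n}. real (num_exits (L2 \<epsilon> n) xs v) \<ge> \<rho> * ln (real n)}) \<longlonglongrightarrow> 1"
      by (rule tendsto_sandwich[OF lower _ lim tendsto_const]) (simp add: measure_pmf.prob_le_1)
  qed
qed simp

end
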